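(* Let $\kappa\in\mathbb R$ and $\tau>0$ with $\kappa\neq\tau^2$. The Jacobi osculating rank of every geodesic of $M^3(\kappa,\tau)$ is two, except for the Hopf fibers, where it is zero. Moreover, for every unit vector $u\in T_oM^3(\kappa,\tau)$: (i) for all $t\in\mathbb R$, $$R_u(t)=R_u+\frac1\tau\Big(\sin(\tau t)\,R_u'(0)+\frac1\tau\big(1-\cos(\tau t)\big)R_u''(0)\Big);$$ (ii) if $u=u(\theta,\phi)$ with $\theta\in\,]0,\pi[$ and $\phi\in[0,2\pi]$, then $R_u(t)$ is a circle in the Euclidean space $\mathcal S(T_oM)$ of radius $\frac{\sqrt2}{2}\,|\tau^2-\kappa|\sin^2\theta$.
   Context: $M=M^3(\kappa,\tau)$ denotes the connected, simply connected 3-dimensional Lie group whose Lie algebra has a basis $\{u_1,u_2,u_3\}$ with $[u_1,u_2]=\tau u_3$, $[u_2,u_3]=\frac{\kappa}{\tau}u_1$, $[u_3,u_1]=\frac{\kappa}{\tau}u_2$, equipped with the left-invariant Riemannian metric for which $\{u_1,u_2,u_3\}$ is orthonormal. This is a naturally reductive homogeneous Riemannian manifold. The origin $o$ is the identity, $e_i\in T_oM$ is the value of $u_i$ at $o$, and $\xi=u_3$ is the Hopf vector field (a unit Killing field); its integral curves, which are geodesics, are the Hopf fibers. $u(\theta,\phi)=\sin\theta\cos\phi\,e_1+\sin\theta\sin\phi\,e_2+\cos\theta\,e_3$, $\theta\in[0,\pi]$, $\phi\in[0,2\pi]$. For a unit vector $u\in T_oM$, $\gamma_u$ is the unit-speed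 geodesic with $\gamma_u(0)=o$, $\gamma_u'(0)=u$. The curvature convention is $R(X,Y)=\nabla_{[X,Y]}-[\nabla_X,\nabla_Y]$, the Jacobi operator along $\gamma_u$ is $R_{\gamma_u}=R(\gamma_u',\cdot)\gamma_u'$, and $R_u=R(u,\cdot)u$. With $\tau_u^t:T_oM\to T_{\gamma_u(t)}M$ the Levi-Civita parallel translation along $\gamma_u$, set $R_u(t)=(\tau_u^t)^{-1}\circ R_{\gamma_u(t)}\circ\tau_u^t$, a curve in the space $\mathcal S(T_oM)$ of self-adjoint operators of $T_oM$, which is Euclidean with inner product $\langle K,K'\rangle=\sum_i\langle K(e_i),K'(e_i)\rangle$ for an orthonormal basis $\{e_i\}$ of $T_oM$. A smooth curve $\alpha$ in a vector space has constant osculating rank $r$ if for every $t$ the vectors $\alpha'(t),\dots,\alpha^{(r)}(t)$ are linearly independent and $\alpha'(t),\dots,\alpha^{(r+1)}(t)$ are linearly dependent. The curve $R_u(t)$ always has constant osculating rank; this number is the Jacobi osculating rank of $\gamma_u$. For geodesics not through $o$ the notion is the same with $o$ replaced by the starting point (by homogeneity one may move it to $o$ by an isometry). *)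

theory Defs
  imports "HOL-Analysis.Analysis" "HOL-Algebra.Group"
begin

section \<open>Smooth maps between manifolds\<close>

primrec Ck_on :: "nat \<Rightarrow> 'a::real_normed_vector set \<Rightarrow> ('a \<Rightarrow> 'b::real_normed_vector) \<Rightarrow> bool" where
  "Ck_on 0 S f \<longleftrightarrow> continuous_on S f"
| "Ck_on (Suc k) S f \<longleftrightarrow>
     f differentiable_on S \<and> (\<forall>v. Ck_on k S (\<lambda>x. frechet_derivative f (at x) v))"

text \<open>Only used on open subsets of finite-dimensional spaces, where this is the usual notion of a
  \<open>C\<^sup>\<infinity>\<close> map.\<close>

definition smooth_on :: "'a::real_normed_vector set \<Rightarrow> ('a \<Rightarrow> 'b::real_normed_vector) \<Rightarrow> bool" where
  "smooth_on S f \<longleftrightarrow> (\<forall>k. Ck_on k S f)"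

type_synonym ('m, 'e) atlas = "('m set \<times> ('m \<Rightarrow> 'e)) set"

definition smooth_atlas :: "('m::topological_space, 'e::euclidean_space) atlas \<Rightarrow> bool" where
  "smooth_atlas A \<longleftrightarrow>
     (\<Union>(U, \<phi>)\<in>A. U) = UNIV \<and>
     (\<forall>(U, \<phi>)\<in>A. open U \<and> open (\<phi> ` U) \<and> homeomorphism U (\<phi> ` U) \<phi> (inv_into U \<phi>)) \<and>
     (\<forall>(U, \<phi>)\<in>A. \<forall>(V, \<psi>)\<in>A. smooth_on (\<phi> ` (U \<inter> V)) (\<psi> \<circ> inv_into U \<phi>))"

definition euclidean_atlas :: "('e::euclidean_space, 'e) atlas" where
  "euclidean_atlas = {(UNIV, id)}"

definition product_atlas :: "('m, 'e) atlas \<Rightarrow> ('n, 'f) atlas \<Rightarrow> ('m \<times> 'n, 'e \<times> 'f) atlas" where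
  "product_atlas A B = {(U \<times> V, map_prod \<phi> \<psi>) | U \<phi> V \<psi>. (U, \<phi>) \<in> A \<and> (V, \<psi>) \<in> B}"

definition smooth_map ::
  "('m::topological_space, 'e::euclidean_space) atlas \<Rightarrow> ('n::topological_space, 'f::euclidean_space) atlas
    \<Rightarrow> ('m \<Rightarrow> 'n) \<Rightarrow> bool" where
  "smooth_map A B F \<longleftrightarrow> continuous_on UNIV F \<and>
     (\<forall>(U, \<phi>)\<in>A. \<forall>(V, \<psi>)\<in>B. smooth_on (\<phi> ` (U \<inter> F -` V)) (\<psi> \<circ> F \<circ> inv_into U \<phi>))"

definition Cinf :: "('m::topological_space, 'e::euclidean_space) atlas \<Rightarrow> ('m \<Rightarrow> real) set" where
  "Cinf A = {f. smooth_map A euclidean_atlas f}"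


section \<open>Tangent vectors and vector fields\<close>

text \<open>Tangent vectors are derivations of the algebra of smooth functions. They are set to 0 on
  non-smooth functions, so that equality of tangent vectors is equality in the logic.\<close>

type_synonym 'm tangent = "('m \<Rightarrow> real) \<Rightarrow> real"
type_synonym 'm field = "'m \<Rightarrow> 'm tangent"

definition tangent_space :: "('m::topological_space, 'e::euclidean_space) atlas \<Rightarrow> 'm \<Rightarrow> 'm tangent set" where
  "tangent_space A p = {v.
     (\<forall>f\<in>Cinf A. \<forall>h\<in>Cinf A. v (\<lambda>x. f x + h x) = v f + v h) \<and>
     (\<forall>c. \<forall>f\<in>Cinf A. v (\<lambda>x. c * f x) = c * v f) \<and>
     (\<forall>f\<in>Cinf A. \<forall>h\<in>Cinf A. v (\<lambda>x. f x * h x) = v f * h p + f p * v h) \<and>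
     (\<forall>f. f \<notin> Cinf A \<longrightarrow> v f = 0)}"

definition vector_fields :: "('m::topological_space, 'e::euclidean_space) atlas \<Rightarrow> 'm field set" where
  "vector_fields A =
     {X. (\<forall>p. X p \<in> tangent_space A p) \<and> (\<forall>f\<in>Cinf A. (\<lambda>p. X p f) \<in> Cinf A)}"

definition lie_bracket ::
  "('m::topological_space, 'e::euclidean_space) atlas \<Rightarrow> 'm field \<Rightarrow> 'm field \<Rightarrow> 'm field" where
  "lie_bracket A X Y = (\<lambda>p f.
     if f \<in> Cinf A then X p (\<lambda>q. Y q f) - Y p (\<lambda>q. X q f) else 0)"

definition velocity ::
  "('m::topological_space, 'e::euclidean_space) atlas \<Rightarrow> (real \<Rightarrow> 'm) \<Rightarrow> real \<Rightarrow> 'm tangent" where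
  "velocity A \<gamma> t = (\<lambda>f. if f \<in> Cinf A then deriv (f \<circ> \<gamma>) t else 0)"


section \<open>Riemannian metrics and the Levi-Civita connection\<close>

definition riemannian_metric ::
  "('m::topological_space, 'e::euclidean_space) atlas \<Rightarrow> ('m \<Rightarrow> 'm tangent \<Rightarrow> 'm tangent \<Rightarrow> real) \<Rightarrow> bool" where
  "riemannian_metric A g \<longleftrightarrow>
     (\<forall>p. \<forall>v\<in>tangent_space A p. \<forall>w\<in>tangent_space A p. g p v w = g p w v) \<and>
     (\<forall>p. \<forall>v\<in>tangent_space A p. \<forall>v'\<in>tangent_space A p. \<forall>w\<in>tangent_space A p.
        g p (\<lambda>f. v f + v' f) w = g p v w + g p v' w) \<and>
     (\<forall>p c. \<forall>v\<in>tangent_space A p. \<forall>w\<in>tangent_space A p. g p (\<lambda>f. c * v f) w = c * g p v w) \<and>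
     (\<forall>p. \<forall>v\<in>tangent_space A p. v \<noteq> (\<lambda>f. 0) \<longrightarrow> g p v v > 0) \<and>
     (\<forall>X\<in>vector_fields A. \<forall>Y\<in>vector_fields A. (\<lambda>p. g p (X p) (Y p)) \<in> Cinf A)"

definition affine_connection ::
  "('m::topological_space, 'e::euclidean_space) atlas \<Rightarrow> ('m field \<Rightarrow> 'm field \<Rightarrow> 'm field) \<Rightarrow> bool" where
  "affine_connection A nabla \<longleftrightarrow>
     (\<forall>X\<in>vector_fields A. \<forall>Y\<in>vector_fields A. nabla X Y \<in> vector_fields A) \<and>
     (\<forall>X\<in>vector_fields A. \<forall>X'\<in>vector_fields A. \<forall>Y\<in>vector_fields A.
        nabla (\<lambda>p f. X p f + X' p f) Y = (\<lambda>p f. nabla X Y p f + nabla X' Y p f)) \<and>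
     (\<forall>h\<in>Cinf A. \<forall>X\<in>vector_fields A. \<forall>Y\<in>vector_fields A.
        nabla (\<lambda>p f. h p * X p f) Y = (\<lambda>p f. h p * nabla X Y p f)) \<and>
     (\<forall>X\<in>vector_fields A. \<forall>Y\<in>vector_fields A. \<forall>Y'\<in>vector_fields A.
        nabla X (\<lambda>p f. Y p f + Y' p f) = (\<lambda>p f. nabla X Y p f + nabla X Y' p f)) \<and>
     (\<forall>h\<in>Cinf A. \<forall>X\<in>vector_fields A. \<forall>Y\<in>vector_fields A.
        nabla X (\<lambda>p f. h p * Y p f) = (\<lambda>p f. X p h * Y p f + h p * nabla X Y p f))"

definition levi_civita ::
  "('m::topological_space, 'e::euclidean_space) atlas \<Rightarrow> ('m \<Rightarrow> 'm tangent \<Rightarrow> 'm tangent \<Rightarrow> real)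
    \<Rightarrow> ('m field \<Rightarrow> 'm field \<Rightarrow> 'm field) \<Rightarrow> bool" where
  "levi_civita A g nabla \<longleftrightarrow> affine_connection A nabla \<and>
     (\<forall>X\<in>vector_fields A. \<forall>Y\<in>vector_fields A.
        (\<lambda>p f. nabla X Y p f - nabla Y X p f) = lie_bracket A X Y) \<and>
     (\<forall>X\<in>vector_fields A. \<forall>Y\<in>vector_fields A. \<forall>Z\<in>vector_fields A. \<forall>p.
        X p (\<lambda>q. g q (Y q) (Z q)) = g p (nabla X Y p) (Z p) + g p (Y p) (nabla X Z p))"

text \<open>Sign convention: \<open>R(X,Y) = \<nabla>\<^bsub>[X,Y]\<^esub> - [\<nabla>\<^bsub>X\<^esub>, \<nabla>\<^bsub>Y\<^esub>]\<close>.\<close>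

definition curvature ::
  "('m::topological_space, 'e::euclidean_space) atlas \<Rightarrow> ('m field \<Rightarrow> 'm field \<Rightarrow> 'm field)
    \<Rightarrow> 'm field \<Rightarrow> 'm field \<Rightarrow> 'm field \<Rightarrow> 'm field" where
  "curvature A nabla X Y Z = (\<lambda>p f.
     nabla (lie_bracket A X Y) Z p f - (nabla X (nabla Y Z) p f - nabla Y (nabla X Z) p f))"


section \<open>Lie groups and the spaces \<open>M\<^sup>3(\<kappa>,\<tau>)\<close>\<close>

text \<open>The underlying set of the group is the whole type; the type is arbitrary.\<close>

definition lie_group ::
  "'m::{t2_space,second_countable_topology} monoid \<Rightarrow> ('m, 'e::euclidean_space) atlas \<Rightarrow> bool" where
  "lie_group G A \<longleftrightarrow> group G \<and> carrier G = UNIV \<and> smooth_atlas A \<and>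
     smooth_map (product_atlas A A) A (\<lambda>(x, y). x \<otimes>\<^bsub>G\<^esub> y) \<and>
     smooth_map A A (\<lambda>x. inv\<^bsub>G\<^esub> x)"

definition left_push ::
  "'m::topological_space monoid \<Rightarrow> ('m, 'e::euclidean_space) atlas \<Rightarrow> 'm \<Rightarrow> 'm tangent \<Rightarrow> 'm tangent" where
  "left_push G A a v = (\<lambda>f. if f \<in> Cinf A then v (\<lambda>x. f (a \<otimes>\<^bsub>G\<^esub> x)) else 0)"

definition left_invariant_fields ::
  "'m::topological_space monoid \<Rightarrow> ('m, 'e::euclidean_space) atlas \<Rightarrow> 'm field set" where
  "left_invariant_fields G A =
     {X \<in> vector_fields A. \<forall>a p. X (a \<otimes>\<^bsub>G\<^esub> p) = left_push G A a (X p)}"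

definition left_invariant_metric ::
  "'m::topological_space monoid \<Rightarrow> ('m, 'e::euclidean_space) atlas
    \<Rightarrow> ('m \<Rightarrow> 'm tangent \<Rightarrow> 'm tangent \<Rightarrow> real) \<Rightarrow> bool" where
  "left_invariant_metric G A g \<longleftrightarrow> riemannian_metric A g \<and>
     (\<forall>a p. \<forall>v\<in>tangent_space A p. \<forall>w\<in>tangent_space A p.
        g (a \<otimes>\<^bsub>G\<^esub> p) (left_push G A a v) (left_push G A a w) = g p v w)"

definition frame_comb :: "(3 \<Rightarrow> 'm field) \<Rightarrow> 'm \<Rightarrow> real^3 \<Rightarrow> 'm tangent" where
  "frame_comb u p c = (\<lambda>f. \<Sum>i\<in>UNIV. c $ i * u i p f)"

text \<open>The Lie algebra of left-invariant vector fields is identified with the tangent space at the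
  identity by evaluation, as usual.\<close>

definition lie_algebra_basis ::
  "'m::topological_space monoid \<Rightarrow> ('m, 'e::euclidean_space) atlas \<Rightarrow> (3 \<Rightarrow> 'm field) \<Rightarrow> bool" where
  "lie_algebra_basis G A u \<longleftrightarrow> (\<forall>i. u i \<in> left_invariant_fields G A) \<and>
     (\<forall>v\<in>tangent_space A \<one>\<^bsub>G\<^esub>. \<exists>!c. v = frame_comb u \<one>\<^bsub>G\<^esub> c)"

definition M3_space ::
  "real \<Rightarrow> real \<Rightarrow> 'm::{t2_space,second_countable_topology} monoid \<Rightarrow> ('m, real^3) atlas
    \<Rightarrow> (3 \<Rightarrow> 'm field) \<Rightarrow> ('m \<Rightarrow> 'm tangent \<Rightarrow> 'm tangent \<Rightarrow> real) \<Rightarrow> bool" where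
  "M3_space \<kappa> \<tau> G A u g \<longleftrightarrow>
     lie_group G A \<and> connected (UNIV :: 'm set) \<and> simply_connected (UNIV :: 'm set) \<and>
     lie_algebra_basis G A u \<and>
     lie_bracket A (u 1) (u 2) = (\<lambda>p f. \<tau> * u 3 p f) \<and>
     lie_bracket A (u 2) (u 3) = (\<lambda>p f. \<kappa> / \<tau> * u 1 p f) \<and>
     lie_bracket A (u 3) (u 1) = (\<lambda>p f. \<kappa> / \<tau> * u 2 p f) \<and>
     left_invariant_metric G A g \<and>
     (\<forall>p i j. g p (u i p) (u j p) = (if i = j then 1 else 0))"


section \<open>Geodesics, parallel translation and Jacobi operators\<close>

text \<open>In this section \<open>u\<close> is a global \<open>g\<close>-orthonormal frame. Fields along curves are
  differentiated through their components in this frame.\<close>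

definition coords ::
  "('m \<Rightarrow> 'm tangent \<Rightarrow> 'm tangent \<Rightarrow> real) \<Rightarrow> (3 \<Rightarrow> 'm field) \<Rightarrow> 'm \<Rightarrow> 'm tangent \<Rightarrow> real^3" where
  "coords g u p v = (\<chi> i. g p v (u i p))"

definition smooth_field_along ::
  "('m::topological_space, 'e::euclidean_space) atlas \<Rightarrow> ('m \<Rightarrow> 'm tangent \<Rightarrow> 'm tangent \<Rightarrow> real)
    \<Rightarrow> (3 \<Rightarrow> 'm field) \<Rightarrow> (real \<Rightarrow> 'm) \<Rightarrow> (real \<Rightarrow> 'm tangent) \<Rightarrow> bool" where
  "smooth_field_along A g u \<gamma> V \<longleftrightarrow>
     (\<forall>t. V t \<in> tangent_space A (\<gamma> t)) \<and> smooth_on UNIV (\<lambda>t. coords g u (\<gamma> t) (V t))"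

text \<open>With \<open>\<gamma>' = \<Sum> x\<^sub>i u\<^sub>i\<close> and \<open>V = \<Sum> V\<^sub>i u\<^sub>i\<close> along \<open>\<gamma>\<close>, the covariant derivative of \<open>V\<close> is
  \<open>\<Sum> V\<^sub>i' u\<^sub>i + \<Sum> x\<^sub>i V\<^sub>j \<nabla>\<^bsub>u\<^sub>i\<^esub> u\<^sub>j\<close>.\<close>

definition covariant_derivative ::
  "('m::topological_space, 'e::euclidean_space) atlas \<Rightarrow> ('m \<Rightarrow> 'm tangent \<Rightarrow> 'm tangent \<Rightarrow> real)
    \<Rightarrow> (3 \<Rightarrow> 'm field) \<Rightarrow> ('m field \<Rightarrow> 'm field \<Rightarrow> 'm field)
    \<Rightarrow> (real \<Rightarrow> 'm) \<Rightarrow> (real \<Rightarrow> 'm tangent) \<Rightarrow> real \<Rightarrow> 'm tangent" where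
  "covariant_derivative A g u nabla \<gamma> V t = (\<lambda>f.
     frame_comb u (\<gamma> t) (vector_derivative (\<lambda>s. coords g u (\<gamma> s) (V s)) (at t)) f +
     (\<Sum>i\<in>UNIV. \<Sum>j\<in>UNIV.
        coords g u (\<gamma> t) (velocity A \<gamma> t) $ i * coords g u (\<gamma> t) (V t) $ j *
        nabla (u i) (u j) (\<gamma> t) f))"

definition parallel_along ::
  "('m::topological_space, 'e::euclidean_space) atlas \<Rightarrow> ('m \<Rightarrow> 'm tangent \<Rightarrow> 'm tangent \<Rightarrow> real)
    \<Rightarrow> (3 \<Rightarrow> 'm field) \<Rightarrow> ('m field \<Rightarrow> 'm field \<Rightarrow> 'm field)
    \<Rightarrow> (real \<Rightarrow> 'm) \<Rightarrow> (real \<Rightarrow> 'm tangent) \<Rightarrow> bool" where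
  "parallel_along A g u nabla \<gamma> V \<longleftrightarrow> smooth_field_along A g u \<gamma> V \<and>
     (\<forall>t. covariant_derivative A g u nabla \<gamma> V t = (\<lambda>f. 0))"

definition unit_geodesic ::
  "('m::topological_space, 'e::euclidean_space) atlas \<Rightarrow> ('m \<Rightarrow> 'm tangent \<Rightarrow> 'm tangent \<Rightarrow> real)
    \<Rightarrow> (3 \<Rightarrow> 'm field) \<Rightarrow> ('m field \<Rightarrow> 'm field \<Rightarrow> 'm field) \<Rightarrow> (real \<Rightarrow> 'm) \<Rightarrow> bool" where
  "unit_geodesic A g u nabla \<gamma> \<longleftrightarrow> smooth_map euclidean_atlas A \<gamma> \<and>
     parallel_along A g u nabla \<gamma> (velocity A \<gamma>) \<and>
     (\<forall>t. g (\<gamma> t) (velocity A \<gamma> t) (velocity A \<gamma> t) = 1)"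

definition parallel_translation ::
  "('m::topological_space, 'e::euclidean_space) atlas \<Rightarrow> ('m \<Rightarrow> 'm tangent \<Rightarrow> 'm tangent \<Rightarrow> real)
    \<Rightarrow> (3 \<Rightarrow> 'm field) \<Rightarrow> ('m field \<Rightarrow> 'm field \<Rightarrow> 'm field)
    \<Rightarrow> (real \<Rightarrow> 'm) \<Rightarrow> real \<Rightarrow> 'm tangent \<Rightarrow> 'm tangent" where
  "parallel_translation A g u nabla \<gamma> t v =
     (THE w. \<exists>V. parallel_along A g u nabla \<gamma> V \<and> V 0 = v \<and> V t = w)"

text \<open>The curvature is tensorial, so its value on tangent vectors at \<open>p\<close> may be computed with any
  extensions to vector fields; the ones used have constant components in the frame.\<close>

definition frame_extension ::
  "('m \<Rightarrow> 'm tangent \<Rightarrow> 'm tangent \<Rightarrow> real) \<Rightarrow> (3 \<Rightarrow> 'm field) \<Rightarrow> 'm \<Rightarrow> 'm tangent \<Rightarrow> 'm field" where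
  "frame_extension g u p v = (\<lambda>q. frame_comb u q (coords g u p v))"

definition curvature_at ::
  "('m::topological_space, 'e::euclidean_space) atlas \<Rightarrow> ('m \<Rightarrow> 'm tangent \<Rightarrow> 'm tangent \<Rightarrow> real)
    \<Rightarrow> (3 \<Rightarrow> 'm field) \<Rightarrow> ('m field \<Rightarrow> 'm field \<Rightarrow> 'm field)
    \<Rightarrow> 'm \<Rightarrow> 'm tangent \<Rightarrow> 'm tangent \<Rightarrow> 'm tangent \<Rightarrow> 'm tangent" where
  "curvature_at A g u nabla p x y z =
     curvature A nabla (frame_extension g u p x) (frame_extension g u p y) (frame_extension g u p z) p"

definition jacobi_operator ::
  "('m::topological_space, 'e::euclidean_space) atlas \<Rightarrow> ('m \<Rightarrow> 'm tangent \<Rightarrow> 'm tangent \<Rightarrow> real)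
    \<Rightarrow> (3 \<Rightarrow> 'm field) \<Rightarrow> ('m field \<Rightarrow> 'm field \<Rightarrow> 'm field)
    \<Rightarrow> 'm \<Rightarrow> 'm tangent \<Rightarrow> 'm tangent \<Rightarrow> 'm tangent" where
  "jacobi_operator A g u nabla p x = (\<lambda>y. curvature_at A g u nabla p x y x)"

definition transported_jacobi_operator ::
  "('m::topological_space, 'e::euclidean_space) atlas \<Rightarrow> ('m \<Rightarrow> 'm tangent \<Rightarrow> 'm tangent \<Rightarrow> real)
    \<Rightarrow> (3 \<Rightarrow> 'm field) \<Rightarrow> ('m field \<Rightarrow> 'm field \<Rightarrow> 'm field)
    \<Rightarrow> (real \<Rightarrow> 'm) \<Rightarrow> real \<Rightarrow> 'm tangent \<Rightarrow> 'm tangent" where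
  "transported_jacobi_operator A g u nabla \<gamma> t =
     inv_into (tangent_space A (\<gamma> 0)) (parallel_translation A g u nabla \<gamma> t)
     \<circ> jacobi_operator A g u nabla (\<gamma> t) (velocity A \<gamma> t)
     \<circ> parallel_translation A g u nabla \<gamma> t"

text \<open>The matrix of an operator of the tangent space at \<open>p\<close> in the orthonormal basis
  \<open>u\<^sub>1(p), u\<^sub>2(p), u\<^sub>3(p)\<close>. This identifies the space of self-adjoint operators with
  \<open>symmetric_matrices\<close>; the inner product \<open>\<Sum> \<langle>K e\<^sub>i, K' e\<^sub>i\<rangle>\<close> becomes the inner product of
  the type \<open>real^3^3\<close>.\<close>

definition operator_matrix ::
  "('m \<Rightarrow> 'm tangent \<Rightarrow> 'm tangent \<Rightarrow> real) \<Rightarrow> (3 \<Rightarrow> 'm field)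
    \<Rightarrow> 'm \<Rightarrow> ('m tangent \<Rightarrow> 'm tangent) \<Rightarrow> real^3^3" where
  "operator_matrix g u p K = (\<chi> i j. g p (u i p) (K (u j p)))"

definition symmetric_matrices :: "(real^3^3) set" where
  "symmetric_matrices = {K. transpose K = K}"

definition jacobi_curve ::
  "('m::topological_space, 'e::euclidean_space) atlas \<Rightarrow> ('m \<Rightarrow> 'm tangent \<Rightarrow> 'm tangent \<Rightarrow> real)
    \<Rightarrow> (3 \<Rightarrow> 'm field) \<Rightarrow> ('m field \<Rightarrow> 'm field \<Rightarrow> 'm field)
    \<Rightarrow> (real \<Rightarrow> 'm) \<Rightarrow> real \<Rightarrow> real^3^3" where
  "jacobi_curve A g u nabla \<gamma> t =
     operator_matrix g u (\<gamma> 0) (transported_jacobi_operator A g u nabla \<gamma> t)"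


section \<open>Osculating rank, Hopf fibers and circles\<close>

definition curve_deriv :: "nat \<Rightarrow> (real \<Rightarrow> 'v::real_normed_vector) \<Rightarrow> real \<Rightarrow> 'v" where
  "curve_deriv k \<alpha> = ((\<lambda>\<beta> t. vector_derivative \<beta> (at t)) ^^ k) \<alpha>"

text \<open>Independence of the derivatives of orders \<open>1, \<dots>, r\<close> as a family, not as a set.\<close>

definition derivs_independent :: "(real \<Rightarrow> 'v::real_normed_vector) \<Rightarrow> real \<Rightarrow> nat \<Rightarrow> bool" where
  "derivs_independent \<alpha> t r \<longleftrightarrow>
     (\<forall>c. (\<Sum>k=1..r. c k *\<^sub>R curve_deriv k \<alpha> t) = 0 \<longrightarrow> (\<forall>k\<in>{1..r}. c k = 0))"

definition constant_osculating_rank :: "(real \<Rightarrow> 'v::real_normed_vector) \<Rightarrow> nat \<Rightarrow> bool" where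
  "constant_osculating_rank \<alpha> r \<longleftrightarrow> smooth_on UNIV \<alpha> \<and>
     (\<forall>t. derivs_independent \<alpha> t r \<and> \<not> derivs_independent \<alpha> t (r + 1))"

definition has_jacobi_osculating_rank ::
  "('m::topological_space, 'e::euclidean_space) atlas \<Rightarrow> ('m \<Rightarrow> 'm tangent \<Rightarrow> 'm tangent \<Rightarrow> real)
    \<Rightarrow> (3 \<Rightarrow> 'm field) \<Rightarrow> ('m field \<Rightarrow> 'm field \<Rightarrow> 'm field) \<Rightarrow> (real \<Rightarrow> 'm) \<Rightarrow> nat \<Rightarrow> bool" where
  "has_jacobi_osculating_rank A g u nabla \<gamma> r \<longleftrightarrow>
     constant_osculating_rank (jacobi_curve A g u nabla \<gamma>) r"

text \<open>A unit-speed geodesic parametrizes a Hopf fiber in either direction.\<close>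

definition hopf_fiber ::
  "('m::topological_space, 'e::euclidean_space) atlas \<Rightarrow> (3 \<Rightarrow> 'm field) \<Rightarrow> (real \<Rightarrow> 'm) \<Rightarrow> bool" where
  "hopf_fiber A u \<gamma> \<longleftrightarrow>
     (\<forall>t. velocity A \<gamma> t = u 3 (\<gamma> t)) \<or> (\<forall>t. velocity A \<gamma> t = (\<lambda>f. - u 3 (\<gamma> t) f))"

definition angular_vector :: "(3 \<Rightarrow> 'm field) \<Rightarrow> 'm \<Rightarrow> real \<Rightarrow> real \<Rightarrow> 'm tangent" where
  "angular_vector u p \<theta> \<phi> =
     frame_comb u p (vector [sin \<theta> * cos \<phi>, sin \<theta> * sin \<phi>, cos \<theta>])"

definition circle_in :: "'v::euclidean_space set \<Rightarrow> real \<Rightarrow> 'v set \<Rightarrow> bool" where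
  "circle_in S r C \<longleftrightarrow> r > 0 \<and>
     (\<exists>P c. affine P \<and> aff_dim P = 2 \<and> P \<subseteq> S \<and> c \<in> P \<and> C = sphere c r \<inter> P)"

end

theory Submission
  imports Defs
begin

text \<open>In the left-invariant orthonormal frame every tensor has constant components, so everything
  takes place in \<open>\<real>\<^sup>3\<close>. Write \<open>e\<^sub>3\<close> for the Hopf direction, \<open>x\<close> for the components of the velocity and
  \<open>\<omega> = (\<kappa>/\<tau> - \<tau>) x\<^sub>3\<close>, which is constant. The covariant derivative along the geodesic is
  \<open>V' + ((\<tau>/2) x + \<omega> e\<^sub>3) \<times> V\<close>; hence \<open>x\<close> rotates about \<open>e\<^sub>3\<close> with speed \<open>-\<omega>\<close>, and parallel translation
  is the rotation about \<open>x(0)\<close> with speed \<open>-\<tau>/2\<close> followed by the rotation about \<open>e\<^sub>3\<close> with speed \<open>-\<omega>\<close>.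
  The Jacobi operator is \<open>(\<tau>\<^sup>2/4)(1 - x x\<^sup>T) + (\<kappa> - \<tau>\<^sup>2) w w\<^sup>T\<close> with \<open>w = e\<^sub>3 \<times> x\<close>, and it commutes with rotations
  about \<open>e\<^sub>3\<close>. So \<open>R\<^sub>u(t)\<close> is obtained by rotating \<open>w\<close> about \<open>x(0)\<close> through the angle \<open>\<tau>t/2\<close>; as \<open>w\<close> enters
  quadratically, \<open>R\<^sub>u(t)\<close> is a circle of angular speed \<open>\<tau>\<close>, degenerate exactly when \<open>w = 0\<close>.\<close>

section \<open>Calculus of \<open>C\<^sup>k\<close> maps\<close>

text \<open>On an open set equality is equality near each point, so the Frechet derivatives agree as
  well and the induction passes to every directional derivative.\<close>

lemma Ck_on_cong:
  assumes "open S" "\<And>x. x \<in> S \<Longrightarrow> f x = h x" "Ck_on k S f"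
  shows "Ck_on k S h"
  using assms(2,3)
proof (induction k arbitrary: f h)
  case 0
  then show ?case by (metis Ck_on.simps(1) continuous_on_cong)
next
  case (Suc k)
  have d: "(h has_derivative frechet_derivative f (at x)) (at x)" if "x \<in> S" for x
  proof -
    have "f differentiable at x"
      using Suc.prems(2) that assms(1) by (simp add: differentiable_on_eq_differentiable_at)
    then have "(f has_derivative frechet_derivative f (at x)) (at x)"
      by (simp add: frechet_derivative_works)
    then show ?thesis
      using has_derivative_transform_within_open[OF _ assms(1) that] Suc.prems(1) by blast
  qed
  have e: "frechet_derivative h (at x) = frechet_derivative f (at x)" if "x \<in> S" for x
    using d[OF that] frechet_derivative_at by metis
  have "h differentiable_on S"
    using d assms(1) by (auto simp: differentiable_on_eq_differentiable_at differentiable_def)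
  moreover have "Ck_on k S (\<lambda>x. frechet_derivative h (at x) v)" for v
    using Suc.IH[of "\<lambda>x. frechet_derivative f (at x) v"] Suc.prems(2) e by auto
  ultimately show ?case by simp
qed

text \<open>Uniqueness of the derivative on an open set lets any explicit formula stand in for
  \<open>frechet_derivative\<close>.\<close>

lemma Ck_on_SucI:
  assumes "open S" "\<And>x. x \<in> S \<Longrightarrow> (f has_derivative f' x) (at x)"
    "\<And>v. Ck_on k S (\<lambda>x. f' x v)"
  shows "Ck_on (Suc k) S f"
proof -
  have "f differentiable_on S"
    using assms by (auto simp: differentiable_on_eq_differentiable_at differentiable_def)
  moreover have "Ck_on k S (\<lambda>x. frechet_derivative f (at x) v)" for v
  proof (rule Ck_on_cong[OF assms(1) _ assms(3)[of v]])
    show "f' x v = frechet_derivative f (at x) v" if "x \<in> S" for x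
      by (simp add: frechet_derivative_at[OF assms(2)[OF that]])
  qed
  ultimately show ?thesis by simp
qed

lemma Ck_on_SucD:
  assumes "open S" "Ck_on (Suc k) S f" "x \<in> S"
  shows "(f has_derivative frechet_derivative f (at x)) (at x)"
  using assms by (simp add: differentiable_on_eq_differentiable_at frechet_derivative_works)

lemma Ck_on_mono: "Ck_on (Suc k) S f \<Longrightarrow> Ck_on k S f"
proof (induction k arbitrary: f)
  case 0
  then show ?case by (auto simp: differentiable_imp_continuous_on)
next
  case (Suc k)
  then show ?case by (metis Ck_on.simps(2))
qed

text \<open>Used to prove smoothness in a chart by shrinking to neighbourhoods whose image lies in
  one chart of the target.\<close>

lemma Ck_on_local:
  assumes "open S" "\<And>x. x \<in> S \<Longrightarrow> \<exists>T. open T \<and> x \<in> T \<and> Ck_on k T f"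
  shows "Ck_on k S f"
  using assms(2)
proof (induction k arbitrary: f)
  case 0
  then show ?case
    using assms(1) by (metis Ck_on.simps(1) continuous_on_eq_continuous_at)
next
  case (Suc k)
  have "f differentiable at x" if "x \<in> S" for x
    using Suc.prems[OF that] by (auto simp: differentiable_on_eq_differentiable_at)
  moreover have "Ck_on k S (\<lambda>x. frechet_derivative f (at x) v)" for v
    using Suc.prems by (intro Suc.IH) fastforce
  ultimately show ?case
    using assms(1) by (simp add: differentiable_on_eq_differentiable_at)
qed

lemma Ck_on_const: "open S \<Longrightarrow> Ck_on k S (\<lambda>x. c)"
proof (induction k arbitrary: c)
  case (Suc k)
  show ?case
    by (rule Ck_on_SucI[OF Suc.prems, where f' = "\<lambda>x v. 0"]) (auto intro: Suc)
qed simp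

lemma Ck_on_bounded_linear_comp:
  assumes "open S" "bounded_linear L" "Ck_on k S f"
  shows "Ck_on k S (\<lambda>x. L (f x))"
  using assms(3)
proof (induction k arbitrary: f)
  case 0
  then show ?case
    using bounded_linear.continuous_on[OF assms(2)] by simp
next
  case (Suc k)
  show ?case
  proof (rule Ck_on_SucI[OF assms(1)])
    show "((\<lambda>x. L (f x)) has_derivative (\<lambda>v. L (frechet_derivative f (at x) v))) (at x)"
      if "x \<in> S" for x
      using bounded_linear.has_derivative[OF assms(2) Ck_on_SucD[OF assms(1) Suc.prems that]] .
  qed (use Suc in auto)
qed

lemma Ck_on_affine:
  assumes "open S" "bounded_linear L"
  shows "Ck_on k S (\<lambda>x. c + L x)"
proof (cases k)
  case 0
  then show ?thesis
    using continuous_on_add[OF continuous_on_const linear_continuous_on[OF assms(2)]] by simp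
next
  case (Suc j)
  have "((\<lambda>x. c + L x) has_derivative L) (at x)" for x
    using has_derivative_add[OF has_derivative_const bounded_linear_imp_has_derivative[OF assms(2)]]
    by simp
  then have "Ck_on (Suc j) S (\<lambda>x. c + L x)"
    using Ck_on_SucI[OF assms(1), where f' = "\<lambda>x. L"] Ck_on_const[OF assms(1)] by blast
  then show ?thesis using Suc by simp
qed

lemma Ck_on_add:
  assumes "open S" "Ck_on k S f" "Ck_on k S h"
  shows "Ck_on k S (\<lambda>x. f x + h x)"
  using assms(2,3)
proof (induction k arbitrary: f h)
  case 0
  then show ?case by (auto intro: continuous_on_add)
next
  case (Suc k)
  show ?case
  proof (rule Ck_on_SucI[OF assms(1)])
    show "((\<lambda>x. f x + h x) has_derivative
        (\<lambda>v. frechet_derivative f (at x) v + frechet_derivative h (at x) v)) (at x)"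
      if "x \<in> S" for x
      using Suc.prems that by (intro has_derivative_add Ck_on_SucD[OF assms(1)]) auto
  qed (use Suc in auto)
qed

lemma Ck_on_sum:
  assumes "open S" "finite I" "\<And>i. i \<in> I \<Longrightarrow> Ck_on k S (f i)"
  shows "Ck_on k S (\<lambda>x. \<Sum>i\<in>I. f i x)"
  using assms(2,3)
  by (induction I rule: finite_induct) (auto intro: Ck_on_const Ck_on_add assms(1))

lemma Ck_on_scaleR:
  assumes "open S" "Ck_on k S f" "Ck_on k S h"
  shows "Ck_on k S (\<lambda>x. f x *\<^sub>R h x)"
  using assms(2,3)
proof (induction k arbitrary: f h)
  case 0
  then show ?case by (auto intro: continuous_on_scaleR)
next
  case (Suc k)
  show ?case
  proof (rule Ck_on_SucI[OF assms(1)])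
    show "((\<lambda>x. f x *\<^sub>R h x) has_derivative
        (\<lambda>v. f x *\<^sub>R frechet_derivative h (at x) v + frechet_derivative f (at x) v *\<^sub>R h x)) (at x)"
      if "x \<in> S" for x
      using Suc.prems that by (intro has_derivative_scaleR Ck_on_SucD[OF assms(1)]) auto
    show "Ck_on k S (\<lambda>x. f x *\<^sub>R frechet_derivative h (at x) v + frechet_derivative f (at x) v *\<^sub>R h x)" for v
      using Suc.prems Ck_on_mono[OF Suc.prems(1)] Ck_on_mono[OF Suc.prems(2)]
      by (intro Ck_on_add[OF assms(1)] Suc.IH) auto
  qed
qed

text \<open>The chain rule expanded in a basis: the derivative becomes a sum of scalar functions
  times derivatives of \<open>f\<close> in the fixed directions \<open>b\<close>. Only fixed
  directions occur in \<open>Ck_on\<close>, so this is the form to which the induction hypothesis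
  applies.\<close>

lemma Ck_on_compose:
  fixes h :: "'a::real_normed_vector \<Rightarrow> 'b::euclidean_space"
  assumes "open S" "open T" "h ` S \<subseteq> T" "Ck_on k S h" "Ck_on k T f"
  shows "Ck_on k S (\<lambda>x. f (h x))"
  using assms(4,5)
proof (induction k arbitrary: f)
  case 0
  then show ?case using assms(3) by (auto intro: continuous_on_compose2)
next
  case (Suc k)
  let ?D = "\<lambda>x v. \<Sum>b\<in>Basis. (frechet_derivative h (at x) v \<bullet> b) *\<^sub>R frechet_derivative f (at (h x)) b"
  show ?case
  proof (rule Ck_on_SucI[OF assms(1)])
    show "((\<lambda>x. f (h x)) has_derivative ?D x) (at x)" if "x \<in> S" for x
    proof -
      have hd: "(h has_derivative frechet_derivative h (at x)) (at x)"
        using Ck_on_SucD[OF assms(1) Suc.prems(1) that] .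
      have fd: "(f has_derivative frechet_derivative f (at (h x))) (at (h x))"
        using Ck_on_SucD[OF assms(2) Suc.prems(2)] that assms(3) by auto
      have "frechet_derivative f (at (h x)) v = (\<Sum>b\<in>Basis. (v \<bullet> b) *\<^sub>R frechet_derivative f (at (h x)) b)"
        for v
      proof -
        interpret linear "frechet_derivative f (at (h x))"
          using fd has_derivative_linear by blast
        have "frechet_derivative f (at (h x)) v = frechet_derivative f (at (h x)) (\<Sum>b\<in>Basis. (v \<bullet> b) *\<^sub>R b)"
          by (simp add: euclidean_representation)
        then show ?thesis by (simp only: sum scale)
      qed
      then have "(\<lambda>v. frechet_derivative f (at (h x)) (frechet_derivative h (at x) v)) = ?D x"
        by blast
      then show ?thesis
        using has_derivative_compose[OF hd fd] by metis
    qed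
    show "Ck_on k S (\<lambda>x. ?D x v)" for v
    proof (intro Ck_on_sum Ck_on_scaleR assms(1))
      fix b :: 'b
      show "Ck_on k S (\<lambda>x. frechet_derivative h (at x) v \<bullet> b)"
        using Suc.prems(1) by (intro Ck_on_bounded_linear_comp[OF assms(1) bounded_linear_inner_left]) auto
      show "Ck_on k S (\<lambda>x. frechet_derivative f (at (h x)) b)"
        using Suc.prems Ck_on_mono[OF Suc.prems(1)] by (intro Suc.IH) auto
    qed simp
  qed
qed

text \<open>Proved jointly because each function is, up to a factor, the derivative of the
  other.\<close>

lemma Ck_on_sin_cos:
  assumes "open S"
  shows "Ck_on k S (\<lambda>t::real. sin (c * t)) \<and> Ck_on k S (\<lambda>t::real. cos (c * t))"
proof (induction k)
  case 0
  then show ?case by (auto intro!: continuous_intros)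
next
  case (Suc k)
  have lin: "Ck_on k S (\<lambda>t. (v * c) *\<^sub>R cos (c * t))" "Ck_on k S (\<lambda>t. (- (v * c)) *\<^sub>R sin (c * t))" for v
    using Suc Ck_on_scaleR[OF assms Ck_on_const[OF assms]] by blast+
  have "Ck_on (Suc k) S (\<lambda>t. sin (c * t))"
  proof (rule Ck_on_SucI[OF assms _ lin(1)])
    show "((\<lambda>t. sin (c * t)) has_derivative (\<lambda>v. (v * c) *\<^sub>R cos (c * t))) (at t)" for t
      by (auto intro!: derivative_eq_intros)
  qed
  moreover have "Ck_on (Suc k) S (\<lambda>t. cos (c * t))"
  proof (rule Ck_on_SucI[OF assms _ lin(2)])
    show "((\<lambda>t. cos (c * t)) has_derivative (\<lambda>v. (- (v * c)) *\<^sub>R sin (c * t))) (at t)" for t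
      by (auto intro!: derivative_eq_intros)
  qed
  ultimately show ?case by blast
qed


section \<open>Smooth functions and tangent vectors on a Lie group\<close>

lemma smooth_atlasD:
  assumes "smooth_atlas A" "(U, \<phi>) \<in> A"
  shows "open U" "open (\<phi> ` U)" "homeomorphism U (\<phi> ` U) \<phi> (inv_into U \<phi>)"
proof -
  have "\<forall>(U, \<phi>)\<in>A. open U \<and> open (\<phi> ` U) \<and> homeomorphism U (\<phi> ` U) \<phi> (inv_into U \<phi>)"
    using assms(1) unfolding smooth_atlas_def by (elim conjE)
  from bspec[OF this assms(2)]
  show "open U" "open (\<phi> ` U)" "homeomorphism U (\<phi> ` U) \<phi> (inv_into U \<phi>)" by simp_all
qed

lemma smooth_atlas_cover:
  assumes "smooth_atlas A"
  obtains U \<phi> where "(U, \<phi>) \<in> A" "p \<in> U"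
proof -
  have "p \<in> (\<Union>(U, \<phi>)\<in>A. U)"
    using assms unfolding smooth_atlas_def by (metis UNIV_I)
  then show ?thesis using that by blast
qed

lemma Cinf_iff:
  "f \<in> Cinf A \<longleftrightarrow> continuous_on UNIV f \<and> (\<forall>(U, \<phi>)\<in>A. \<forall>k. Ck_on k (\<phi> ` U) (\<lambda>x. f (inv_into U \<phi> x)))"
  by (simp add: Cinf_def smooth_map_def euclidean_atlas_def smooth_on_def comp_def)

lemma Cinf_const: "smooth_atlas A \<Longrightarrow> (\<lambda>p. c) \<in> Cinf A"
  unfolding Cinf_iff by (auto intro: Ck_on_const smooth_atlasD)

lemma Cinf_add: "smooth_atlas A \<Longrightarrow> f \<in> Cinf A \<Longrightarrow> h \<in> Cinf A \<Longrightarrow> (\<lambda>p. f p + h p) \<in> Cinf A"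
  unfolding Cinf_iff by (auto intro!: Ck_on_add smooth_atlasD continuous_on_add)

lemma Cinf_mult:
  assumes "smooth_atlas A" "f \<in> Cinf A" "h \<in> Cinf A"
  shows "(\<lambda>p. f p * h p) \<in> Cinf A"
proof -
  have "Ck_on k (\<phi> ` U) (\<lambda>x. f (inv_into U \<phi> x) *\<^sub>R h (inv_into U \<phi> x))" if "(U, \<phi>) \<in> A" for U \<phi> k
    using Ck_on_scaleR[OF smooth_atlasD(2)[OF assms(1) that]] assms(2,3) that unfolding Cinf_iff by blast
  then show ?thesis
    using assms(2,3) unfolding Cinf_iff by (auto intro: continuous_on_mult)
qed

lemma Cinf_cmult: "smooth_atlas A \<Longrightarrow> f \<in> Cinf A \<Longrightarrow> (\<lambda>p. c * f p) \<in> Cinf A"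
  using Cinf_mult[OF _ Cinf_const] by blast

text \<open>Left translation by \<open>a\<close> is the group multiplication restricted to the slice
  of pairs \<open>(a, x)\<close>. In charts it is the smooth multiplication composed with an affine
  inclusion, and then followed by \<open>f\<close>.\<close>

lemma Cinf_left_translation:
  fixes A :: "('m::{t2_space,second_countable_topology}, 'e::euclidean_space) atlas"
  assumes "lie_group G A" "f \<in> Cinf A"
  shows "(\<lambda>x. f (a \<otimes>\<^bsub>G\<^esub> x)) \<in> Cinf A"
proof -
  let ?m = "\<lambda>(x, y). x \<otimes>\<^bsub>G\<^esub> y"
  have A: "smooth_atlas A" and mult: "smooth_map (product_atlas A A) A ?m"
    using assms(1) by (auto simp: lie_group_def)
  then have mc: "continuous_on UNIV ?m"
    by (simp add: smooth_map_def)
  have ac: "continuous_on UNIV (\<lambda>x. a \<otimes>\<^bsub>G\<^esub> x)"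
    using continuous_on_compose2[OF mc, of UNIV "\<lambda>x. (a, x)"] by (simp add: continuous_on_Pair)
  have "Ck_on k (\<phi> ` U) (\<lambda>x. f (a \<otimes>\<^bsub>G\<^esub> inv_into U \<phi> x))" if U: "(U, \<phi>) \<in> A" for U \<phi> k
  proof (rule Ck_on_local)
    note U' = smooth_atlasD[OF A U]
    show "open (\<phi> ` U)" by (rule U')
    fix y assume "y \<in> \<phi> ` U"
    then obtain p where p: "p \<in> U" "y = \<phi> p" by blast
    obtain V \<psi> where V: "(V, \<psi>) \<in> A" "a \<otimes>\<^bsub>G\<^esub> p \<in> V"
      using smooth_atlas_cover[OF A] .
    obtain W \<eta> where W: "(W, \<eta>) \<in> A" "a \<in> W"
      using smooth_atlas_cover[OF A] .
    note V' = smooth_atlasD[OF A V(1)] and W' = smooth_atlasD[OF A W(1)]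
    have invU: "inv_into U \<phi> (\<phi> x) = x" if "x \<in> U" for x
      using U'(3) that by (simp add: homeomorphism_def)
    have invV: "inv_into V \<psi> (\<psi> x) = x" if "x \<in> V" for x
      using V'(3) that by (simp add: homeomorphism_def)
    have invW: "inv_into W \<eta> (\<eta> x) = x" if "x \<in> W" for x
      using W'(3) that by (simp add: homeomorphism_def)
    have cU: "continuous_on (\<phi> ` U) (inv_into U \<phi>)" and cW: "continuous_on (\<eta> ` W) (inv_into W \<eta>)"
      using U'(3) W'(3) by (simp_all add: homeomorphism_def)
    let ?i = "inv_into (W \<times> U) (map_prod \<eta> \<phi>)"
    have inv: "?i (\<eta> b, \<phi> x) = (b, x)" if "b \<in> W" "x \<in> U" for b x
    proof -
      have "inj_on \<eta> W" "inj_on \<phi> U"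
        by (metis inj_onI invW, metis inj_onI invU)
      then show ?thesis
        using inv_into_f_f[OF map_prod_inj_on, of \<eta> W \<phi> U "(b, x)"] that by simp
    qed
    \<comment> \<open>\<open>N\<close> is the part of the chart image that the translation sends
      into the single chart \<open>V\<close>; \<open>D\<close> below is the domain of the
      multiplication in these charts.\<close>
    define N where "N = \<phi> ` U \<inter> (\<lambda>x. a \<otimes>\<^bsub>G\<^esub> inv_into U \<phi> x) -` V"
    have "open N"
      unfolding N_def
      by (intro continuous_open_preimage U' V' continuous_on_compose2[OF ac cU]) simp
    define D where "D = map_prod \<eta> \<phi> ` ((W \<times> U) \<inter> ?m -` V)"
    \<comment> \<open>As a preimage of the open set \<open>V\<close> under a continuous map on an
      open product, \<open>D\<close> is open.\<close>
    have "D = (\<eta> ` W \<times> \<phi> ` U) \<inter> (\<lambda>z. ?m (inv_into W \<eta> (fst z), inv_into U \<phi> (snd z))) -` V"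
      unfolding D_def by (force simp: invU invW)
    moreover have "continuous_on (\<eta> ` W \<times> \<phi> ` U) (\<lambda>z. ?m (inv_into W \<eta> (fst z), inv_into U \<phi> (snd z)))"
      by (intro continuous_on_compose2[OF mc] continuous_on_Pair continuous_on_compose2[OF cU]
          continuous_on_compose2[OF cW] continuous_intros) auto
    ultimately have "open D"
      using continuous_open_preimage[OF _ open_Times[OF W'(2) U'(2)] V'(1)] by simp
    have "Ck_on k D (\<psi> \<circ> ?m \<circ> ?i)"
      using mult W(1) U V(1) unfolding smooth_map_def product_atlas_def smooth_on_def D_def by blast
    moreover have "Ck_on k N (\<lambda>x. (\<eta> a, x))"
    proof -
      have "bounded_linear (\<lambda>x::'e. (0::'e, x))"
        by (intro bounded_linear_Pair bounded_linear_zero bounded_linear_ident)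
      from Ck_on_affine[OF \<open>open N\<close> this, of k "(\<eta> a, 0)"] show ?thesis by simp
    qed
    moreover have "(\<lambda>x. (\<eta> a, x)) ` N \<subseteq> D"
    proof
      fix z assume "z \<in> (\<lambda>x. (\<eta> a, x)) ` N"
      then obtain x where x: "x \<in> U" "a \<otimes>\<^bsub>G\<^esub> x \<in> V" "z = (\<eta> a, \<phi> x)"
        by (auto simp: N_def invU)
      then have "z = map_prod \<eta> \<phi> (a, x)" "(a, x) \<in> (W \<times> U) \<inter> ?m -` V"
        using W(2) by auto
      then show "z \<in> D" unfolding D_def by blast
    qed
    ultimately have h: "Ck_on k N (\<lambda>x. (\<psi> \<circ> ?m \<circ> ?i) (\<eta> a, x))"
      using Ck_on_compose[OF \<open>open N\<close> \<open>open D\<close>] by blast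
    have e: "(\<psi> \<circ> ?m \<circ> ?i) (\<eta> a, x) = \<psi> (a \<otimes>\<^bsub>G\<^esub> inv_into U \<phi> x)" if "x \<in> N" for x
      using that inv W(2) by (auto simp: N_def invU)
    have "Ck_on k (\<psi> ` V) (\<lambda>x. f (inv_into V \<psi> x))"
      using assms(2) V(1) unfolding Cinf_iff by blast
    moreover have "(\<lambda>x. (\<psi> \<circ> ?m \<circ> ?i) (\<eta> a, x)) ` N \<subseteq> \<psi> ` V"
      using e by (auto simp: N_def simp del: comp_apply)
    ultimately have "Ck_on k N (\<lambda>x. f (inv_into V \<psi> ((\<psi> \<circ> ?m \<circ> ?i) (\<eta> a, x))))"
      using Ck_on_compose[OF \<open>open N\<close> V'(2) _ h] by blast
    then have "Ck_on k N (\<lambda>x. f (a \<otimes>\<^bsub>G\<^esub> inv_into U \<phi> x))"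
    proof (rule Ck_on_cong[OF \<open>open N\<close>, rotated])
      fix x assume "x \<in> N"
      then show "f (inv_into V \<psi> ((\<psi> \<circ> ?m \<circ> ?i) (\<eta> a, x))) = f (a \<otimes>\<^bsub>G\<^esub> inv_into U \<phi> x)"
        unfolding e[OF \<open>x \<in> N\<close>] by (simp add: N_def invV)
    qed
    moreover have "y \<in> N"
      using p V(2) by (simp add: N_def invU)
    ultimately show "\<exists>T. open T \<and> y \<in> T \<and> Ck_on k T (\<lambda>x. f (a \<otimes>\<^bsub>G\<^esub> inv_into U \<phi> x))"
      using \<open>open N\<close> by blast
  qed
  moreover have "continuous_on UNIV (\<lambda>x. f (a \<otimes>\<^bsub>G\<^esub> x))"
    using assms(2) continuous_on_compose2[OF _ ac] unfolding Cinf_iff by blast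
  ultimately show ?thesis
    unfolding Cinf_iff by blast
qed

section \<open>Tangent vectors as derivations\<close>

lemma tangent_spaceD:
  assumes "v \<in> tangent_space A p" "f \<in> Cinf A"
  shows "h \<in> Cinf A \<Longrightarrow> v (\<lambda>x. f x + h x) = v f + v h"
    and "v (\<lambda>x. c * f x) = c * v f"
    and "h \<in> Cinf A \<Longrightarrow> v (\<lambda>x. f x * h x) = v f * h p + f p * v h"
  using assms by (simp_all add: tangent_space_def)

lemma tangent_add:
  "v \<in> tangent_space A p \<Longrightarrow> w \<in> tangent_space A p \<Longrightarrow> (\<lambda>f. v f + w f) \<in> tangent_space A p"
  by (simp add: tangent_space_def algebra_simps)

lemma tangent_cmult: "v \<in> tangent_space A p \<Longrightarrow> (\<lambda>f. c * v f) \<in> tangent_space A p"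
  by (simp add: tangent_space_def algebra_simps)

text \<open>The Leibniz rule for 1 * 1 = 1 forces a derivation to vanish at the constant 1.\<close>

lemma tangent_const:
  assumes "smooth_atlas A" "v \<in> tangent_space A p"
  shows "v (\<lambda>x. c) = 0"
proof -
  note const = Cinf_const[OF assms(1)]
  have "v (\<lambda>x. 1) = v (\<lambda>x. 1) * 1 + 1 * v (\<lambda>x. 1)"
    using tangent_spaceD(3)[OF assms(2) const const, of 1 1] by simp
  then show ?thesis
    using tangent_spaceD(2)[OF assms(2) const, of c 1] by simp
qed


section \<open>Rotations of \<open>\<real>\<^sup>3\<close>\<close>

unbundle cross3_syntax

text \<open>Rodrigues' formula: for a unit vector \<open>n\<close> this is the rotation about
  \<open>n\<close> through the angle \<open>s\<close>.\<close>

definition rot :: "real^3 \<Rightarrow> real \<Rightarrow> real^3 \<Rightarrow> real^3" where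
  "rot n s v = cos s *\<^sub>R v + sin s *\<^sub>R (n \<times> v) + ((1 - cos s) * (n \<bullet> v)) *\<^sub>R n"

lemma rot_0 [simp]: "rot n 0 v = v"
  by (simp add: rot_def)

lemma linear_rot: "linear (rot n s)"
  by (rule linearI) (simp_all add: rot_def cross_add_right cross_mult_right inner_add_right algebra_simps)

lemma inner_rot: "n \<bullet> n = 1 \<Longrightarrow> n \<bullet> rot n s v = n \<bullet> v"
  by (simp add: rot_def inner_add_right dot_cross_self algebra_simps)

lemma cross_rot:
  "n \<bullet> n = 1 \<Longrightarrow> n \<times> rot n s v = cos s *\<^sub>R (n \<times> v) + sin s *\<^sub>R ((n \<bullet> v) *\<^sub>R n - v)"
  by (simp add: rot_def cross_add_right cross_mult_right Lagrange)

lemma rot_minus_rot: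
  assumes "n \<bullet> n = 1"
  shows "rot n (- s) (rot n s v) = v"
proof -
  define C S where "C = cos s" and "S = sin s"
  have "C * C + S * S = 1"
    using sin_cos_squared_add2[of s] by (simp add: C_def S_def power2_eq_square)
  have "rot n (- s) (rot n s v) = C *\<^sub>R rot n s v - S *\<^sub>R (n \<times> rot n s v) + ((1 - C) * (n \<bullet> v)) *\<^sub>R n"
    by (simp add: rot_def[of n "- s"] inner_rot[OF assms] C_def S_def)
  also have "\<dots> = (C * C + S * S) *\<^sub>R v + ((n \<bullet> v) * (1 - (C * C + S * S))) *\<^sub>R n"
    unfolding cross_rot[OF assms] by (simp add: rot_def algebra_simps flip: C_def S_def)
  finally show ?thesis using \<open>C * C + S * S = 1\<close> by simp
qed

text \<open>The cross product with \<open>n\<close> is skew and the other two terms are symmetric,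
  so the adjoint is obtained by reversing the angle.\<close>

lemma inner_rot_left: "rot n (- s) y \<bullet> w = y \<bullet> rot n s w"
proof -
  have "(n \<times> y) \<bullet> w = - (y \<bullet> (n \<times> w))"
    by (simp add: cross3_simps)
  then show ?thesis
    by (simp add: rot_def inner_add_left inner_add_right inner_diff_left inner_diff_right inner_commute)
qed

lemma trig_has_vector_derivative:
  fixes X Y Z :: "'v::real_normed_vector"
  shows "((\<lambda>t. X + cos (c * t) *\<^sub>R Y + sin (c * t) *\<^sub>R Z) has_vector_derivative
    cos (c * t) *\<^sub>R (c *\<^sub>R Z) + sin (c * t) *\<^sub>R (- (c *\<^sub>R Y))) (at t)"
proof -
  have "((\<lambda>t. cos (c * t)) has_real_derivative - (c * sin (c * t))) (at t)"
    "((\<lambda>t. sin (c * t)) has_real_derivative c * cos (c * t)) (at t)"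
    by (auto intro!: derivative_eq_intros)
  then have "((\<lambda>t. X + cos (c * t) *\<^sub>R Y + sin (c * t) *\<^sub>R Z) has_vector_derivative
      (0 + (cos (c * t) *\<^sub>R 0 + (- (c * sin (c * t))) *\<^sub>R Y)) +
      (sin (c * t) *\<^sub>R 0 + (c * cos (c * t)) *\<^sub>R Z)) (at t)"
    by (intro has_vector_derivative_add has_vector_derivative_scaleR has_vector_derivative_const)
  then show ?thesis by (simp add: algebra_simps)
qed

lemma bounded_linear_cross3: "bounded_linear (cross3 n)"
  by (intro linear_conv_bounded_linear[THEN iffD1] linearI) (simp_all add: cross_add_right cross_mult_right)

text \<open>The argument \<open>f\<close> may itself depend on time, so that a composition of two
  rotations is differentiated by using the rule twice.\<close>

lemma rot_has_vector_derivative: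
  assumes "n \<bullet> n = 1" and f: "(f has_vector_derivative f') (at t)"
  shows "((\<lambda>t. rot n (c * t) (f t)) has_vector_derivative
    c *\<^sub>R (n \<times> rot n (c * t) (f t)) + rot n (c * t) f') (at t)"
proof -
  have cos: "((\<lambda>t. cos (c * t)) has_real_derivative - (c * sin (c * t))) (at t)"
    and sin: "((\<lambda>t. sin (c * t)) has_real_derivative c * cos (c * t)) (at t)"
    and cos1: "((\<lambda>t. 1 - cos (c * t)) has_real_derivative c * sin (c * t)) (at t)"
    by (auto intro!: derivative_eq_intros)
  have e: "rot n s v = cos s *\<^sub>R v + sin s *\<^sub>R (n \<times> v) + (1 - cos s) *\<^sub>R ((n \<bullet> v) *\<^sub>R n)" for s v
    by (simp add: rot_def)
  have inner: "((\<lambda>t. (n \<bullet> f t) *\<^sub>R n) has_vector_derivative (n \<bullet> f') *\<^sub>R n) (at t)"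
    by (intro bounded_linear.has_vector_derivative[OF _ f] bounded_linear_scaleR_left
        bounded_linear_compose[OF bounded_linear_scaleR_left bounded_linear_inner_right])
  have "((\<lambda>t. rot n (c * t) (f t)) has_vector_derivative
      (cos (c * t) *\<^sub>R f' + (- (c * sin (c * t))) *\<^sub>R f t) +
      (sin (c * t) *\<^sub>R (n \<times> f') + (c * cos (c * t)) *\<^sub>R (n \<times> f t)) +
      ((1 - cos (c * t)) *\<^sub>R ((n \<bullet> f') *\<^sub>R n) + (c * sin (c * t)) *\<^sub>R ((n \<bullet> f t) *\<^sub>R n))) (at t)"
    unfolding e
    by (intro has_vector_derivative_add has_vector_derivative_scaleR cos sin cos1 f inner
        bounded_linear.has_vector_derivative[OF bounded_linear_cross3 f])
  then show ?thesis
    unfolding cross_rot[OF assms(1)]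
    by (rule has_vector_derivative_eq_rhs) (simp add: rot_def algebra_simps)
qed

lemma rot_e3_components:
  "rot (axis 3 1) s v $ 1 = cos s * v $ 1 - sin s * v $ 2"
  "rot (axis 3 1) s v $ 2 = cos s * v $ 2 + sin s * v $ 1"
  "rot (axis 3 1) s v $ 3 = v $ 3"
  by (simp_all add: rot_def cross_components inner_vec_def sum_3 axis_def algebra_simps)

text \<open>The first two components are linear expansions; the third says that the planar rotation
  has determinant cos^2 + sin^2 = 1.\<close>

lemma rot_e3_cross: "rot (axis 3 1) s (x \<times> y) = rot (axis 3 1) s x \<times> rot (axis 3 1) s y"
proof -
  have "(c * x1 - s * x2) * (c * y2 + s * y1) - (c * y1 - s * y2) * (c * x2 + s * x1) =
      (c * c + s * s) * (x1 * y2 - y1 * x2)" for c x1 x2 y1 y2 s :: real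
    by algebra
  moreover have "cos s * cos s + sin s * sin s = 1"
    using sin_cos_squared_add2[of s] by (simp add: power2_eq_square)
  ultimately have "(cos s * x$1 - sin s * x$2) * (cos s * y$2 + sin s * y$1)
      - (cos s * y$1 - sin s * y$2) * (cos s * x$2 + sin s * x$1) = x$1 * y$2 - y$1 * x$2"
    by simp
  then show ?thesis
    unfolding vec_eq_iff forall_3 rot_e3_components cross_components by (simp add: algebra_simps)
qed

text \<open>Since \<open>w t \<times> d t\<close> is orthogonal to \<open>d t\<close>, the length of
  \<open>d\<close> is constant. This gives the uniqueness statement for the geodesic equation and
  for parallel fields.\<close>

lemma cross_ode_zero:
  assumes "\<And>t. (d has_vector_derivative w t \<times> d t) (at t)" "d 0 = 0"
  shows "d t = 0"
proof -
  have "((\<lambda>t. d t \<bullet> d t) has_real_derivative 0) (at t)" for t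
  proof -
    have "((\<lambda>t. d t \<bullet> d t) has_derivative (\<lambda>h. d t \<bullet> (h *\<^sub>R (w t \<times> d t)) + (h *\<^sub>R (w t \<times> d t)) \<bullet> d t)) (at t)"
      using assms(1)[of t] unfolding has_vector_derivative_def by (intro has_derivative_inner)
    then show ?thesis
      by (simp add: dot_cross_self has_field_derivative_def lambda_zero)
  qed
  then have "d t \<bullet> d t = d 0 \<bullet> d 0"
    by (intro DERIV_isconst_all) auto
  then show ?thesis using assms(2) by simp
qed

lemma Ck_on_rot:
  assumes "open S" "Ck_on k S f"
  shows "Ck_on k S (\<lambda>t. rot n (c * t) (f t))"
proof -
  note scale = Ck_on_scaleR[OF assms(1)] and const = Ck_on_const[OF assms(1)]
  note sin = Ck_on_sin_cos[OF assms(1), THEN conjunct1] and cos = Ck_on_sin_cos[OF assms(1), THEN conjunct2]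
  have "Ck_on k S (\<lambda>t. sin (c * t) *\<^sub>R (n \<times> f t))"
    by (rule scale[OF sin Ck_on_bounded_linear_comp[OF assms(1) bounded_linear_cross3 assms(2)]])
  moreover have "Ck_on k S (\<lambda>t. cos (c * t) *\<^sub>R f t)"
    by (rule scale[OF cos assms(2)])
  moreover have "Ck_on k S (\<lambda>t. ((1 + (-1) *\<^sub>R cos (c * t)) *\<^sub>R (n \<bullet> f t)) *\<^sub>R n)"
    by (rule scale[OF scale[OF Ck_on_add[OF assms(1) const scale[OF const cos]]
          Ck_on_bounded_linear_comp[OF assms(1) bounded_linear_inner_right assms(2)]] const])
  ultimately have "Ck_on k S (\<lambda>t. cos (c * t) *\<^sub>R f t + sin (c * t) *\<^sub>R (n \<times> f t)
      + ((1 + (-1) *\<^sub>R cos (c * t)) *\<^sub>R (n \<bullet> f t)) *\<^sub>R n)"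
    using Ck_on_add[OF assms(1)] by blast
  then show ?thesis by (simp add: rot_def)
qed

text \<open>The Levi-Civita connection on fields with constant components is \<open>\<nabla>\<^sub>a b = conn a \<times> b\<close> (Milnor's formula
  for unimodular groups), and \<open>jac x\<close> is the resulting operator \<open>R\<^sub>x\<close>.\<close>

definition conn :: "real \<Rightarrow> real \<Rightarrow> real^3 \<Rightarrow> real^3" where
  "conn \<kappa> \<tau> a = (\<tau> / 2) *\<^sub>R a + ((\<kappa> / \<tau> - \<tau>) * a $ 3) *\<^sub>R axis 3 1"

definition jac :: "real \<Rightarrow> real \<Rightarrow> real^3 \<Rightarrow> real^3 \<Rightarrow> real^3" where
  "jac \<kappa> \<tau> x y = (\<tau>\<^sup>2 / 4) *\<^sub>R ((x \<bullet> x) *\<^sub>R y - (x \<bullet> y) *\<^sub>R x) +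
     ((\<kappa> - \<tau>\<^sup>2) * ((axis 3 1 \<times> x) \<bullet> y)) *\<^sub>R (axis 3 1 \<times> x)"

text \<open>The left side is R(x,y)x for fields with constant components, where zero torsion
  expresses the bracket [x,y] as the difference of the two covariant derivatives.\<close>

lemma conn_curvature:
  assumes "\<tau> \<noteq> 0"
  shows "conn \<kappa> \<tau> (conn \<kappa> \<tau> x \<times> y - conn \<kappa> \<tau> y \<times> x) \<times> x
     - (conn \<kappa> \<tau> x \<times> (conn \<kappa> \<tau> y \<times> x) - conn \<kappa> \<tau> y \<times> (conn \<kappa> \<tau> x \<times> x)) = jac \<kappa> \<tau> x y"
proof -
  \<comment> \<open>Eliminating the quotient turns the claim into a polynomial identity in each
    component.\<close>
  define k where "k = \<kappa> / \<tau>"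
  have k: "\<kappa> = k * \<tau>" using assms by (simp add: k_def)
  have e: "axis 3 (1::real) $ (1::3) = 0" "axis 3 (1::real) $ (2::3) = 0" "axis 3 (1::real) $ (3::3) = 1"
    by (simp_all add: axis_def)
  show ?thesis
    unfolding vec_eq_iff forall_3 conn_def jac_def k_def[symmetric] vector_add_component vector_minus_component
      vector_scaleR_component cross_components inner_vec_def sum_3 inner_real_def e
    unfolding k by (simp add: power2_eq_square field_simps)
qed

text \<open>The operator is built from inner products, cross products and the axis vector, all of
  which rotations about that axis preserve.\<close>

lemma jac_rot_e3: "jac \<kappa> \<tau> (rot (axis 3 1) s x) (rot (axis 3 1) s y) = rot (axis 3 1) s (jac \<kappa> \<tau> x y)"
proof -
  have n: "axis 3 1 \<bullet> (axis 3 1 :: real^3) = 1" by (simp add: inner_axis_axis)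
  have e: "rot (axis 3 1) s (axis 3 1) = axis 3 1"
    unfolding vec_eq_iff forall_3 rot_e3_components by (simp add: axis_def)
  have i: "rot (axis 3 1) s a \<bullet> rot (axis 3 1) s b = a \<bullet> b" for a b
    using inner_rot_left[of "axis 3 1" "- s" a "rot (axis 3 1) s b"] rot_minus_rot[OF n, of s b] by simp
  have c: "axis 3 1 \<times> rot (axis 3 1) s x = rot (axis 3 1) s (axis 3 1 \<times> x)"
    by (simp add: rot_e3_cross e)
  show ?thesis
    unfolding jac_def c i
    by (simp add: linear_add[OF linear_rot] linear_diff[OF linear_rot] linear_scale[OF linear_rot])
qed

text \<open>Conjugating by a rotation about \<open>x\<close> fixes \<open>x\<close> and replaces
  \<open>w\<close> by its rotated copy. As \<open>w\<close> is orthogonal to \<open>x\<close>, the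
  third term of Rodrigues' formula drops out.\<close>

lemma rot_jac_rot:
  assumes "x \<bullet> x = 1"
  defines "w \<equiv> axis 3 1 \<times> x"
  shows "rot x s (jac \<kappa> \<tau> x (rot x (- s) y)) = (\<tau>\<^sup>2 / 4) *\<^sub>R (y - (x \<bullet> y) *\<^sub>R x) +
    ((\<kappa> - \<tau>\<^sup>2) * ((cos s *\<^sub>R w + sin s *\<^sub>R (x \<times> w)) \<bullet> y)) *\<^sub>R (cos s *\<^sub>R w + sin s *\<^sub>R (x \<times> w))"
proof -
  have w: "rot x s w = cos s *\<^sub>R w + sin s *\<^sub>R (x \<times> w)"
    by (simp add: rot_def w_def dot_cross_self)
  have x: "rot x s x = x"
    using assms(1) by (simp add: rot_def flip: scaleR_add_left)
  have y: "rot x s (rot x (- s) y) = y"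
    using rot_minus_rot[OF assms(1), of "- s" y] by simp
  have i: "w \<bullet> rot x (- s) y = rot x s w \<bullet> y"
    using inner_rot_left[of x s y w] by (simp add: inner_commute)
  show ?thesis
    unfolding jac_def w_def[symmetric] i inner_rot[OF assms(1)] assms(1) w[symmetric]
    by (simp add: linear_add[OF linear_rot] linear_diff[OF linear_rot] linear_scale[OF linear_rot] x y)
qed


section \<open>Trigonometric curves\<close>

lemma smooth_on_trig:
  fixes X Y Z :: "'v::real_normed_vector"
  shows "smooth_on UNIV (\<lambda>t::real. X + cos (c * t) *\<^sub>R Y + sin (c * t) *\<^sub>R Z)"
  unfolding smooth_on_def
proof
  fix k
  note const = Ck_on_const[OF open_UNIV] and sc = Ck_on_sin_cos[OF open_UNIV]
  show "Ck_on k UNIV (\<lambda>t::real. X + cos (c * t) *\<^sub>R Y + sin (c * t) *\<^sub>R Z)"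
    by (rule Ck_on_add[OF open_UNIV Ck_on_add[OF open_UNIV const
            Ck_on_scaleR[OF open_UNIV sc[THEN conjunct2] const]]
          Ck_on_scaleR[OF open_UNIV sc[THEN conjunct1] const]])
qed

text \<open>Peels off the innermost derivative, whereas unfolding the iteration exposes the
  outermost one.\<close>

lemma curve_deriv_Suc: "curve_deriv (Suc k) \<alpha> = curve_deriv k (\<lambda>t. vector_derivative \<alpha> (at t))"
  by (simp add: curve_deriv_def funpow_Suc_right del: funpow.simps)

text \<open>Differentiation keeps the trigonometric shape with new coefficients; the explicit
  summand 0 lets the rule rewrite its own result again.\<close>

lemma curve_deriv_trig:
  fixes X Y Z :: "'v::real_normed_vector"
  shows "curve_deriv (Suc k) (\<lambda>t. X + cos (c * t) *\<^sub>R Y + sin (c * t) *\<^sub>R Z) =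
    curve_deriv k (\<lambda>t. 0 + cos (c * t) *\<^sub>R (c *\<^sub>R Z) + sin (c * t) *\<^sub>R (- (c *\<^sub>R Y)))"
  unfolding curve_deriv_Suc vector_derivative_at[OF trig_has_vector_derivative] by simp

lemma curve_deriv_0: "curve_deriv 0 \<alpha> = \<alpha>"
  by (simp add: curve_deriv_def)

lemma curve_deriv_trig_123:
  fixes X Y Z :: "'v::real_normed_vector" and c :: real
  defines "\<alpha> \<equiv> \<lambda>t. X + cos (c * t) *\<^sub>R Y + sin (c * t) *\<^sub>R Z"
  shows "curve_deriv 1 \<alpha> t = c *\<^sub>R (cos (c * t) *\<^sub>R Z - sin (c * t) *\<^sub>R Y)"
    and "curve_deriv 2 \<alpha> t = - (c * c) *\<^sub>R (cos (c * t) *\<^sub>R Y + sin (c * t) *\<^sub>R Z)"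
    and "curve_deriv 3 \<alpha> t = - (c * c) *\<^sub>R curve_deriv 1 \<alpha> t"
  unfolding \<alpha>_def One_nat_def numeral_2_eq_2 numeral_3_eq_3 curve_deriv_trig curve_deriv_0
  by (simp_all add: algebra_simps)

text \<open>The empty family is independent, and the family consisting of the first derivative alone
  is dependent because that derivative is zero.\<close>

lemma osculating_rank_const: "constant_osculating_rank (\<lambda>t. X) 0"
proof -
  have "smooth_on UNIV (\<lambda>t::real. X)"
    using smooth_on_trig[of X 0 0 0] by simp
  moreover have "curve_deriv 1 (\<lambda>t. X) t = 0" for t
    using curve_deriv_trig_123(1)[of X 0 0 0 t] by simp
  then have "\<not> derivs_independent (\<lambda>t. X) t (0 + 1)" for t
    by (auto simp: derivs_independent_def)
  ultimately show ?thesis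
    by (auto simp: constant_osculating_rank_def derivs_independent_def)
qed

lemma osculating_rank_trig_2:
  fixes X Y Z :: "'v::real_normed_vector"
  assumes "c \<noteq> 0" and indep: "\<And>a b. a *\<^sub>R Y + b *\<^sub>R Z = 0 \<Longrightarrow> a = 0 \<and> b = 0"
  shows "constant_osculating_rank (\<lambda>t. X + cos (c * t) *\<^sub>R Y + sin (c * t) *\<^sub>R Z) 2"
    (is "constant_osculating_rank ?\<alpha> 2")
proof -
  note d = curve_deriv_trig_123[of X c Y Z]
  have s2: "(\<Sum>k=1..2. f k) = f 1 + f 2" for f :: "nat \<Rightarrow> 'v"
    by (simp add: numeral_2_eq_2)
  have s3: "(\<Sum>k=1..2 + 1. f k) = f 1 + f 2 + f 3" for f :: "nat \<Rightarrow> 'v"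
    by (simp add: numeral_2_eq_2 numeral_3_eq_3)
  have "derivs_independent ?\<alpha> t 2" for t
    unfolding derivs_independent_def s2
  proof (intro allI impI)
    fix a :: "nat \<Rightarrow> real"
    define C S p q where "C = cos (c * t)" and "S = sin (c * t)" and "p = a 1 * c" and "q = a 2 * (c * c)"
    have CS: "C * C + S * S = 1"
      using sin_cos_squared_add2[of "c * t"] by (simp add: C_def S_def power2_eq_square)
    assume "a 1 *\<^sub>R curve_deriv 1 ?\<alpha> t + a 2 *\<^sub>R curve_deriv 2 ?\<alpha> t = 0"
    then have "(- p * S - q * C) *\<^sub>R Y + (p * C - q * S) *\<^sub>R Z = 0"
      unfolding d C_def[symmetric] S_def[symmetric] p_def q_def by (simp add: algebra_simps)
    then have "- p * S - q * C = 0" "p * C - q * S = 0"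
      using indep by blast+
    \<comment> \<open>The two equations are a linear system for \<open>p\<close> and
      \<open>q\<close> with determinant \<open>C * C + S * S\<close>.\<close>
    then have "p * (C * C + S * S) = 0" "q * (C * C + S * S) = 0"
      by algebra+
    then have "p = 0" "q = 0" by (simp_all add: CS)
    then have "a 1 = 0" "a 2 = 0" using assms(1) by (simp_all add: p_def q_def)
    then show "\<forall>k\<in>{1..2}. a k = 0"
      by (metis atLeastAtMost_iff le_antisym not_less_eq_eq numeral_2_eq_2 One_nat_def)
  qed
  moreover have "\<not> derivs_independent ?\<alpha> t (2 + 1)" for t
  proof
    \<comment> \<open>The relation expresses that the third derivative is -c^2 times the
      first.\<close>
    define a :: "nat \<Rightarrow> real" where "a = (\<lambda>k. if k = 1 then c * c else if k = 3 then 1 else 0)"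
    assume "derivs_independent ?\<alpha> t (2 + 1)"
    moreover have "(\<Sum>k=1..2 + 1. a k *\<^sub>R curve_deriv k ?\<alpha> t) = 0"
      unfolding s3 d(3) by (simp add: a_def)
    ultimately have "\<forall>k\<in>{1..2 + 1}. a k = 0"
      unfolding derivs_independent_def by blast
    then have "a 3 = 0" by (rule bspec) simp
    then show False by (simp add: a_def)
  qed
  ultimately show ?thesis
    using smooth_on_trig unfolding constant_osculating_rank_def by blast
qed

section \<open>Circles and rank-one matrices\<close>

lemma trig_circle:
  fixes X Y Z :: "'v::euclidean_space"
  assumes "c \<noteq> 0" "r > 0" "Y \<bullet> Z = 0" "Y \<bullet> Y = r\<^sup>2" "Z \<bullet> Z = r\<^sup>2"
    and "subspace S" "X \<in> S" "Y \<in> S" "Z \<in> S"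
  shows "circle_in S r (range (\<lambda>t. X + cos (c * t) *\<^sub>R Y + sin (c * t) *\<^sub>R Z))"
proof -
  let ?\<alpha> = "\<lambda>t. X + cos (c * t) *\<^sub>R Y + sin (c * t) *\<^sub>R Z"
  let ?V = "span {Y, Z}"
  \<comment> \<open>The plane of the circle: the translate by the centre \<open>X\<close> of the
    span of \<open>Y\<close> and \<open>Z\<close>.\<close>
  define P where "P = (\<lambda>v. X + v) ` ?V"
  have nz: "Y \<noteq> 0" "Z \<noteq> 0" "Y \<noteq> Z"
    using assms(2-5) by auto
  have V: "v \<in> ?V \<longleftrightarrow> (\<exists>p q. v = p *\<^sub>R Y + q *\<^sub>R Z)" for v
    by (auto simp: span_insert span_singleton) (metis add_diff_cancel_left' diff_add_cancel add.commute)+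
  have "independent {Y, Z}"
    using nz assms(3) by (intro pairwise_orthogonal_independent)
      (auto simp: pairwise_def orthogonal_def inner_commute)
  then have "dim ?V = 2"
    using nz by (simp add: dim_eq_card_independent)
  then have "aff_dim P = 2"
    unfolding P_def by (simp add: aff_dim_translation_eq aff_dim_subspace)
  moreover have "affine P"
    unfolding P_def by (simp add: affine_translation[symmetric] subspace_imp_affine)
  moreover have "?V \<subseteq> S"
    using assms(6-) by (intro span_minimal) auto
  then have "P \<subseteq> S"
    unfolding P_def using assms(6,7) by (auto intro: subspace_add)
  moreover have "X \<in> P"
    unfolding P_def using span_zero by force
  moreover have "range ?\<alpha> = sphere X r \<inter> P"
  proof (intro equalityI subsetI)
    \<comment> \<open>\<open>Y\<close> and \<open>Z\<close> are orthogonal of length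
      \<open>r\<close>, so the sphere condition is the equation of the unit circle for the
      coefficients.\<close>
    have n: "norm (p *\<^sub>R Y + q *\<^sub>R Z) = r \<longleftrightarrow> p\<^sup>2 + q\<^sup>2 = 1" for p q
    proof -
      have "(norm (p *\<^sub>R Y + q *\<^sub>R Z))\<^sup>2 = (p\<^sup>2 + q\<^sup>2) * r\<^sup>2"
        using assms(3-5) unfolding power2_norm_eq_inner
        by (simp add: inner_add_left inner_add_right inner_commute power2_eq_square algebra_simps)
      moreover have "norm (p *\<^sub>R Y + q *\<^sub>R Z) = r \<longleftrightarrow> (norm (p *\<^sub>R Y + q *\<^sub>R Z))\<^sup>2 = r\<^sup>2"
        using assms(2) by (simp add: power2_eq_iff_nonneg)
      ultimately show ?thesis using assms(2) by simp
    qed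
    fix z
    { assume "z \<in> range ?\<alpha>"
      then obtain t where t: "z = X + (cos (c * t) *\<^sub>R Y + sin (c * t) *\<^sub>R Z)"
        by (auto simp: add.assoc)
      then have "dist X z = r"
        using n[of "cos (c * t)" "sin (c * t)"] by (simp add: dist_norm norm_minus_commute add.commute)
      moreover have "z \<in> P"
        unfolding P_def t using V by blast
      ultimately show "z \<in> sphere X r \<inter> P" by simp }
    assume z: "z \<in> sphere X r \<inter> P"
    then obtain v where "z = X + v" "v \<in> ?V"
      unfolding P_def by blast
    then obtain p q where pq: "z = X + (p *\<^sub>R Y + q *\<^sub>R Z)"
      using V[of v] by metis
    then have "p\<^sup>2 + q\<^sup>2 = 1"
      using z n[of p q] unfolding pq by (simp add: dist_norm norm_minus_commute add.commute)
    then obtain s where "p = cos s" "q = sin s"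
      using sincos_total_2pi by blast
    \<comment> \<open>The angle \<open>s\<close> is reached at time \<open>s / c\<close>.\<close>
    then have "z = ?\<alpha> (s / c)"
      using assms(1) by (simp add: pq add.assoc)
    then show "z \<in> range ?\<alpha>" by blast
  qed
  ultimately show ?thesis
    unfolding circle_in_def using assms(2) by blast
qed

text \<open>The rank-one matrix of the operator sending y to (b . y) a.\<close>

definition outer :: "real^'n \<Rightarrow> real^'m \<Rightarrow> real^'m^'n" where
  "outer a b = (\<chi> i j. a $ i * b $ j)"

lemma inner_outer: "outer a b \<bullet> outer c d = (a \<bullet> c) * (b \<bullet> d)"
  by (simp add: outer_def inner_vec_def sum_product mult_ac) (rule sum.swap)

lemma subspace_symmetric_matrices: "subspace symmetric_matrices"
  by (auto simp: subspace_def symmetric_matrices_def transpose_def vec_eq_iff)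


section \<open>The Levi-Civita connection in the frame\<close>

locale M3 =
  fixes \<kappa> \<tau> :: real
    and G :: "'m::{t2_space,second_countable_topology} monoid"
    and A :: "('m, real^3) atlas"
    and u :: "3 \<Rightarrow> 'm field"
    and g :: "'m \<Rightarrow> 'm tangent \<Rightarrow> 'm tangent \<Rightarrow> real"
    and nabla :: "'m field \<Rightarrow> 'm field \<Rightarrow> 'm field"
  assumes tau: "\<tau> > 0" and M3: "M3_space \<kappa> \<tau> G A u g" and LC: "levi_civita A g nabla"
begin

lemma lie: "lie_group G A" and metric: "riemannian_metric A g"
  and basis: "lie_algebra_basis G A u"
  and orthonormal: "g p (u i p) (u j p) = (if i = j then 1 else 0)"
  and bracket: "lie_bracket A (u 1) (u 2) = (\<lambda>p f. \<tau> * u 3 p f)"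
    "lie_bracket A (u 2) (u 3) = (\<lambda>p f. \<kappa> / \<tau> * u 1 p f)"
    "lie_bracket A (u 3) (u 1) = (\<lambda>p f. \<kappa> / \<tau> * u 2 p f)"
  using M3 by (simp_all add: M3_space_def left_invariant_metric_def)

lemma atlas: "smooth_atlas A"
  using lie by (simp add: lie_group_def)

lemma u_field: "u i \<in> vector_fields A"
  and u_left_invariant: "u i (a \<otimes>\<^bsub>G\<^esub> p) = left_push G A a (u i p)"
  using basis by (auto simp: lie_algebra_basis_def left_invariant_fields_def)

lemma field_tangent: "X \<in> vector_fields A \<Longrightarrow> X p \<in> tangent_space A p"
  by (simp add: vector_fields_def)

lemma u_tangent: "u i p \<in> tangent_space A p"
  by (rule field_tangent[OF u_field])

lemma frame_comb_sum: "frame_comb u p c = (\<lambda>f. c$1 * u 1 p f + c$2 * u 2 p f + c$3 * u 3 p f)"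
  by (simp add: frame_comb_def sum_3)

lemma frame_comb_tangent: "frame_comb u p c \<in> tangent_space A p"
  unfolding frame_comb_sum by (intro tangent_add tangent_cmult u_tangent)

lemma frame_comb_field: "(\<lambda>p. frame_comb u p c) \<in> vector_fields A"
proof -
  have "(\<lambda>p. frame_comb u p c f) \<in> Cinf A" if "f \<in> Cinf A" for f
    unfolding frame_comb_sum using u_field that
    by (intro Cinf_add Cinf_cmult atlas) (auto simp: vector_fields_def)
  then show ?thesis
    using frame_comb_tangent by (simp add: vector_fields_def)
qed

lemma frame_comb_linear:
  "frame_comb u p (a + b) = (\<lambda>f. frame_comb u p a f + frame_comb u p b f)"
  "frame_comb u p (a - b) = (\<lambda>f. frame_comb u p a f - frame_comb u p b f)"
  "frame_comb u p (c *\<^sub>R a) = (\<lambda>f. c * frame_comb u p a f)"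
  "frame_comb u p (- a) = (\<lambda>f. - frame_comb u p a f)"
  "frame_comb u p 0 = (\<lambda>f. 0)"
  by (simp_all add: frame_comb_sum fun_eq_iff algebra_simps)

lemma frame_comb_axis: "frame_comb u p (axis i 1) = u i p"
  by (simp add: frame_comb_def fun_eq_iff axis_def if_distrib[of "\<lambda>x. x * _"] cong: if_cong)

lemma g_add: "v \<in> tangent_space A p \<Longrightarrow> v' \<in> tangent_space A p \<Longrightarrow> w \<in> tangent_space A p \<Longrightarrow>
    g p (\<lambda>f. v f + v' f) w = g p v w + g p v' w"
  and g_cmult: "v \<in> tangent_space A p \<Longrightarrow> w \<in> tangent_space A p \<Longrightarrow> g p (\<lambda>f. c * v f) w = c * g p v w"
  and g_sym: "v \<in> tangent_space A p \<Longrightarrow> w \<in> tangent_space A p \<Longrightarrow> g p v w = g p w v"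
  using metric unfolding riemannian_metric_def by blast+

lemma g_diff: "v \<in> tangent_space A p \<Longrightarrow> v' \<in> tangent_space A p \<Longrightarrow> w \<in> tangent_space A p \<Longrightarrow>
    g p (\<lambda>f. v f - v' f) w = g p v w - g p v' w"
  using g_add[of v p "\<lambda>f. (-1) * v' f" w] g_cmult[of v' p w "-1"] tangent_cmult[of v' A p "-1"] by simp

lemma g_frame_comb:
  assumes "w \<in> tangent_space A p"
  shows "g p (frame_comb u p c) w = c$1 * g p (u 1 p) w + c$2 * g p (u 2 p) w + c$3 * g p (u 3 p) w"
  unfolding frame_comb_sum using assms
  by (simp add: g_add g_cmult tangent_add tangent_cmult u_tangent)

lemma coords_frame_comb [simp]: "coords g u p (frame_comb u p c) = c"
  by (simp add: coords_def vec_eq_iff forall_3 g_frame_comb[OF u_tangent] orthonormal)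

lemma g_frame_comb_frame_comb: "g p (frame_comb u p a) (frame_comb u p b) = a \<bullet> b"
proof -
  have "g p (u i p) (frame_comb u p b) = b $ i" for i
    using arg_cong[OF coords_frame_comb[of p b], of "\<lambda>x. x $ i"]
    by (simp add: coords_def g_sym[OF u_tangent frame_comb_tangent])
  then show ?thesis
    by (simp add: g_frame_comb[OF frame_comb_tangent] inner_vec_def sum_3)
qed

lemma frame_comb_inject: "frame_comb u p a = frame_comb u p b \<longleftrightarrow> a = b"
  by (metis coords_frame_comb)

text \<open>The basis property is given at the identity only. The vector is pushed there by the
  inverse of \<open>p\<close>, expanded, and pushed back, using left invariance of the
  frame.\<close>

lemma tangent_eq_frame_comb:
  assumes v: "v \<in> tangent_space A p"
  shows "v = frame_comb u p (coords g u p v)"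
proof -
  have grp: "group G" "carrier G = UNIV"
    using lie by (simp_all add: lie_group_def)
  define b where "b = inv\<^bsub>G\<^esub> p"
  have bp: "b \<otimes>\<^bsub>G\<^esub> p = \<one>\<^bsub>G\<^esub>" "b \<otimes>\<^bsub>G\<^esub> (p \<otimes>\<^bsub>G\<^esub> x) = x" "p \<otimes>\<^bsub>G\<^esub> (b \<otimes>\<^bsub>G\<^esub> x) = x" "p \<otimes>\<^bsub>G\<^esub> \<one>\<^bsub>G\<^esub> = p" for x
    using grp group.l_inv[OF grp(1)] group.r_inv[OF grp(1)] group.is_monoid[OF grp(1)]
    by (simp_all add: b_def monoid.m_assoc[symmetric])
  note trans = Cinf_left_translation[OF lie]
  let ?w = "left_push G A b v"
  \<comment> \<open>The pushed vector is again a derivation because left translation preserves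
    smooth functions and their sums and products.\<close>
  have "?w \<in> tangent_space A \<one>\<^bsub>G\<^esub>"
  proof -
    have v': "v (\<lambda>x. f x + h x) = v f + v h" "v (\<lambda>x. f x * h x) = v f * h p + f p * v h"
      "v (\<lambda>x. c * f x) = c * v f" if "f \<in> Cinf A" "h \<in> Cinf A" for f h c
      using tangent_spaceD[OF v that(1)] that(2) by blast+
    have "?w (\<lambda>x. f x + h x) = ?w f + ?w h" "?w (\<lambda>x. f x * h x) = ?w f * h \<one>\<^bsub>G\<^esub> + f \<one>\<^bsub>G\<^esub> * ?w h"
      "?w (\<lambda>x. c * f x) = c * ?w f" if "f \<in> Cinf A" "h \<in> Cinf A" for f h c
    proof -
      show "?w (\<lambda>x. f x + h x) = ?w f + ?w h"
        using v'(1)[OF trans[OF that(1)] trans[OF that(2)]] that by (simp add: left_push_def Cinf_add atlas)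
      show "?w (\<lambda>x. c * f x) = c * ?w f"
        using v'(3)[OF trans[OF that(1)] trans[OF that(2)]] that by (simp add: left_push_def Cinf_cmult atlas)
      show "?w (\<lambda>x. f x * h x) = ?w f * h \<one>\<^bsub>G\<^esub> + f \<one>\<^bsub>G\<^esub> * ?w h"
        using v'(2)[OF trans[OF that(1)] trans[OF that(2)]] that
        by (simp add: left_push_def Cinf_mult atlas bp)
    qed
    then show ?thesis
      by (simp add: tangent_space_def) (simp add: left_push_def)
  qed
  then obtain c where c: "?w = frame_comb u \<one>\<^bsub>G\<^esub> c"
    using basis unfolding lie_algebra_basis_def by blast
  have "v = frame_comb u p c"
  proof
    fix f
    show "v f = frame_comb u p c f"
    \<comment> \<open>Equality of tangent vectors includes the non-smooth functions, where both
      sides are 0 by convention.\<close>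
    proof (cases "f \<in> Cinf A")
      case True
      have "v f = ?w (\<lambda>x. f (p \<otimes>\<^bsub>G\<^esub> x))"
        using trans[OF True] by (simp add: left_push_def bp)
      also have "\<dots> = frame_comb u p c f"
        unfolding c frame_comb_def using u_left_invariant[of _ p "\<one>\<^bsub>G\<^esub>"] True
        by (simp add: left_push_def bp)
      finally show ?thesis .
    next
      case False
      then show ?thesis
        using v frame_comb_tangent[of p c] by (simp add: tangent_space_def)
    qed
  qed
  then show ?thesis by simp
qed

section \<open>Christoffel symbols and curvature in the frame\<close>

lemma affine: "affine_connection A nabla"
  and torsion: "X \<in> vector_fields A \<Longrightarrow> Y \<in> vector_fields A \<Longrightarrow>
    (\<lambda>p f. nabla X Y p f - nabla Y X p f) = lie_bracket A X Y"
  and compatible: "X \<in> vector_fields A \<Longrightarrow> Y \<in> vector_fields A \<Longrightarrow> Z \<in> vector_fields A \<Longrightarrow>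
    X p (\<lambda>q. g q (Y q) (Z q)) = g p (nabla X Y p) (Z p) + g p (Y p) (nabla X Z p)"
  using LC unfolding levi_civita_def by blast+

lemma nabla_field: "X \<in> vector_fields A \<Longrightarrow> Y \<in> vector_fields A \<Longrightarrow> nabla X Y \<in> vector_fields A"
  using affine unfolding affine_connection_def by blast

text \<open>The Koszul argument. Inner products of frame fields are constant, so the symbols
  \<Gamma> are skew in the last two indices; zero torsion gives their antisymmetric part in the
  first two from the brackets. These linear relations determine all 27 symbols.\<close>

lemma nabla_u_u: "nabla (u i) (u j) p = frame_comb u p (conn \<kappa> \<tau> (axis i 1) \<times> axis j 1)"
proof -
  define \<Gamma> where "\<Gamma> i j k = g p (nabla (u i) (u j) p) (u k p)" for i j k
  have t: "nabla (u i) (u j) p \<in> tangent_space A p" for i j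
    by (intro field_tangent nabla_field u_field)
  have "u i p (\<lambda>q. g q (u j q) (u k q)) = 0" for i j k
    unfolding orthonormal by (rule tangent_const[OF atlas u_tangent])
  then have skew: "\<Gamma> i j k + \<Gamma> i k j = 0" for i j k
    using compatible[OF u_field u_field u_field, of i p j k] g_sym[OF u_tangent t, of j i k]
    by (simp add: \<Gamma>_def)
  have tor: "\<Gamma> i j k - \<Gamma> j i k = g p (lie_bracket A (u i) (u j) p) (u k p)" for i j k
    unfolding \<Gamma>_def torsion[OF u_field u_field, symmetric] by (rule g_diff[OF t t u_tangent, symmetric])
  have s: "\<Gamma> 1 2 k - \<Gamma> 2 1 k = (if k = 3 then \<tau> else 0)"
    "\<Gamma> 2 3 k - \<Gamma> 3 2 k = (if k = 1 then \<kappa> / \<tau> else 0)"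
    "\<Gamma> 3 1 k - \<Gamma> 1 3 k = (if k = 2 then \<kappa> / \<tau> else 0)" for k
    unfolding tor bracket g_cmult[OF u_tangent u_tangent] orthonormal by auto
  have "\<forall>i j k. \<Gamma> i j k = (conn \<kappa> \<tau> (axis i 1) \<times> axis j 1) $ k"
    unfolding forall_3 cross_components conn_def
    using s[of 1] s[of 2] s[of 3] skew[of 1 1 1] skew[of 1 1 2] skew[of 1 1 3] skew[of 1 2 2] skew[of 1 2 3] skew[of 1 3 3]
      skew[of 2 1 1] skew[of 2 1 2] skew[of 2 1 3] skew[of 2 2 2] skew[of 2 2 3] skew[of 2 3 3]
      skew[of 3 1 1] skew[of 3 1 2] skew[of 3 1 3] skew[of 3 2 2] skew[of 3 2 3] skew[of 3 3 3]
    by (simp add: axis_def)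
  then have "coords g u p (nabla (u i) (u j) p) = conn \<kappa> \<tau> (axis i 1) \<times> axis j 1"
    by (simp add: coords_def vec_eq_iff \<Gamma>_def)
  then show ?thesis
    using tangent_eq_frame_comb[OF t, of i j] by simp
qed

lemma nabla_add_left: "X \<in> vector_fields A \<Longrightarrow> X' \<in> vector_fields A \<Longrightarrow> Y \<in> vector_fields A \<Longrightarrow>
    nabla (\<lambda>p f. X p f + X' p f) Y = (\<lambda>p f. nabla X Y p f + nabla X' Y p f)"
  and nabla_add_right: "X \<in> vector_fields A \<Longrightarrow> Y \<in> vector_fields A \<Longrightarrow> Y' \<in> vector_fields A \<Longrightarrow>
    nabla X (\<lambda>p f. Y p f + Y' p f) = (\<lambda>p f. nabla X Y p f + nabla X Y' p f)"
  using affine unfolding affine_connection_def by blast+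

lemma nabla_cmult_left:
  assumes "X \<in> vector_fields A" "Y \<in> vector_fields A"
  shows "nabla (\<lambda>p f. c * X p f) Y = (\<lambda>p f. c * nabla X Y p f)"
proof -
  have "\<forall>h\<in>Cinf A. nabla (\<lambda>p f. h p * X p f) Y = (\<lambda>p f. h p * nabla X Y p f)"
    using affine assms unfolding affine_connection_def by blast
  from bspec[OF this Cinf_const[OF atlas, of c]] show ?thesis .
qed

lemma nabla_cmult_right:
  assumes "X \<in> vector_fields A" "Y \<in> vector_fields A"
  shows "nabla X (\<lambda>p f. c * Y p f) = (\<lambda>p f. c * nabla X Y p f)"
proof -
  have "\<forall>h\<in>Cinf A. nabla X (\<lambda>p f. h p * Y p f) = (\<lambda>p f. X p h * Y p f + h p * nabla X Y p f)"
    using affine assms unfolding affine_connection_def by blast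
  from bspec[OF this Cinf_const[OF atlas, of c]] show ?thesis
    by (simp add: tangent_const[OF atlas field_tangent[OF assms(1)]])
qed

lemma field_cmult: "X \<in> vector_fields A \<Longrightarrow> (\<lambda>p f. c * X p f) \<in> vector_fields A"
  and field_add: "X \<in> vector_fields A \<Longrightarrow> Y \<in> vector_fields A \<Longrightarrow> (\<lambda>p f. X p f + Y p f) \<in> vector_fields A"
  by (auto simp: vector_fields_def intro: tangent_cmult tangent_add Cinf_cmult Cinf_add atlas)

text \<open>Constant coefficients have zero derivative, so the Leibniz term vanishes and the
  connection is bilinear here, as is the cross product formula. It therefore suffices to know the
  frame fields.\<close>

lemma nabla_const: "nabla (\<lambda>p. frame_comb u p a) (\<lambda>p. frame_comb u p b) = (\<lambda>p. frame_comb u p (conn \<kappa> \<tau> a \<times> b))"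
proof -
  note fields = field_add field_cmult u_field
  have l: "nabla (\<lambda>p. frame_comb u p a) Y =
      (\<lambda>p f. a$1 * nabla (u 1) Y p f + a$2 * nabla (u 2) Y p f + a$3 * nabla (u 3) Y p f)"
    if "Y \<in> vector_fields A" for Y
    using that unfolding frame_comb_sum by (simp add: nabla_add_left nabla_cmult_left fields)
  have r: "nabla X (\<lambda>p. frame_comb u p b) =
      (\<lambda>p f. b$1 * nabla X (u 1) p f + b$2 * nabla X (u 2) p f + b$3 * nabla X (u 3) p f)"
    if "X \<in> vector_fields A" for X
    using that unfolding frame_comb_sum by (simp add: nabla_add_right nabla_cmult_right fields)
  show ?thesis
    unfolding l[OF frame_comb_field] r[OF u_field] nabla_u_u
    by (simp add: fun_eq_iff frame_comb_sum cross_components conn_def axis_def algebra_simps)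
qed

lemma bracket_const: "lie_bracket A (\<lambda>p. frame_comb u p a) (\<lambda>p. frame_comb u p b) =
    (\<lambda>p. frame_comb u p (conn \<kappa> \<tau> a \<times> b - conn \<kappa> \<tau> b \<times> a))"
  unfolding torsion[OF frame_comb_field frame_comb_field, symmetric] nabla_const frame_comb_linear ..

text \<open>The extensions used to define the curvature have constant components, so the computation
  reduces to \<open>conn_curvature\<close>.\<close>

lemma jacobi_operator_frame_comb:
  "jacobi_operator A g u nabla p (frame_comb u p a) (frame_comb u p b) = frame_comb u p (jac \<kappa> \<tau> a b)"
  unfolding jacobi_operator_def curvature_at_def frame_extension_def coords_frame_comb curvature_def
    bracket_const nabla_const
  using tau by (subst conn_curvature[symmetric]) (simp_all add: frame_comb_linear)

section \<open>Parallel fields as solutions of a linear equation\<close>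

lemma covariant_derivative_frame_comb:
  assumes "velocity A \<gamma> t \<in> tangent_space A (\<gamma> t)" "\<And>s. V s = frame_comb u (\<gamma> s) (y s)"
  shows "covariant_derivative A g u nabla \<gamma> V t =
    frame_comb u (\<gamma> t) (vector_derivative y (at t) + conn \<kappa> \<tau> (coords g u (\<gamma> t) (velocity A \<gamma> t)) \<times> y t)"
  unfolding covariant_derivative_def assms(2) coords_frame_comb nabla_u_u sum_3 frame_comb_linear
  by (simp add: fun_eq_iff frame_comb_sum cross_components conn_def axis_def algebra_simps)

lemma parallel_along_frame_comb:
  assumes "\<And>t. velocity A \<gamma> t \<in> tangent_space A (\<gamma> t)"
  shows "parallel_along A g u nabla \<gamma> (\<lambda>t. frame_comb u (\<gamma> t) (y t)) \<longleftrightarrow> smooth_on UNIV y \<and>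
    (\<forall>t. (y has_vector_derivative (- conn \<kappa> \<tau> (coords g u (\<gamma> t) (velocity A \<gamma> t))) \<times> y t) (at t))"
proof -
  \<comment> \<open>Differentiability, taken from order 1 of smoothness, makes the total function
    \<open>vector_derivative\<close> the actual derivative.\<close>
  have "smooth_on UNIV y \<Longrightarrow> y differentiable at t" for t
    unfolding smooth_on_def by (drule spec[of _ 1]) (simp add: differentiable_on_eq_differentiable_at)
  then have d: "smooth_on UNIV y \<Longrightarrow> (y has_vector_derivative z) (at t) \<longleftrightarrow> vector_derivative y (at t) - z = 0" for t z
    using vector_derivative_works vector_derivative_at by fastforce
  have "frame_comb u p c = (\<lambda>f. 0) \<longleftrightarrow> c = 0" for p c
    using frame_comb_inject[of p c 0] by (simp add: frame_comb_linear)
  then show ?thesis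
    unfolding parallel_along_def smooth_field_along_def coords_frame_comb
      covariant_derivative_frame_comb[OF assms refl]
    using frame_comb_tangent d by (auto simp: eq_neg_iff_add_eq_0)
qed

end


section \<open>Geodesics\<close>

locale M3_geodesic = M3 +
  fixes \<gamma> assumes geodesic: "unit_geodesic A g u nabla \<gamma>"
begin

definition x :: "real \<Rightarrow> real^3" where
  "x t = coords g u (\<gamma> t) (velocity A \<gamma> t)"

lemma velocity_tangent: "velocity A \<gamma> t \<in> tangent_space A (\<gamma> t)"
  using geodesic by (simp add: unit_geodesic_def parallel_along_def smooth_field_along_def)

lemma velocity_eq: "velocity A \<gamma> t = frame_comb u (\<gamma> t) (x t)"
  unfolding x_def by (rule tangent_eq_frame_comb[OF velocity_tangent])

lemma inner_x: "x t \<bullet> x t = 1"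
  using geodesic unfolding unit_geodesic_def velocity_eq g_frame_comb_frame_comb by blast

lemma parallel_iff: "parallel_along A g u nabla \<gamma> (\<lambda>t. frame_comb u (\<gamma> t) (y t)) \<longleftrightarrow> smooth_on UNIV y \<and>
    (\<forall>t. (y has_vector_derivative (- conn \<kappa> \<tau> (x t)) \<times> y t) (at t))"
  unfolding x_def by (rule parallel_along_frame_comb[OF velocity_tangent])

definition \<omega> :: real where "\<omega> = (\<kappa> / \<tau> - \<tau>) * x 0 $ 3"

lemma x_derivative: "(x has_vector_derivative (- conn \<kappa> \<tau> (x t)) \<times> x t) (at t)"
proof -
  have "parallel_along A g u nabla \<gamma> (\<lambda>t. frame_comb u (\<gamma> t) (x t))"
    using geodesic unfolding unit_geodesic_def velocity_eq[symmetric] by simp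
  then show ?thesis unfolding parallel_iff by blast
qed

text \<open>A first integral: the derivative of \<open>x\<close> is a multiple of the axis vector
  crossed with \<open>x\<close>, hence orthogonal to the axis. It expresses that the geodesic makes
  a constant angle with the Hopf field.\<close>

lemma x3_const: "x t $ 3 = x 0 $ 3"
proof -
  have z: "((- conn \<kappa> \<tau> a) \<times> a) $ 3 = 0" for a
    by (simp add: conn_def cross_components axis_def)
  have "((\<lambda>t. x t $ 3) has_real_derivative 0) (at t)" for t
    using bounded_linear.has_vector_derivative[OF bounded_linear_vec_nth[of 3] x_derivative[of t]]
    unfolding z has_real_derivative_iff_has_vector_derivative .
  then have "\<forall>t. ((\<lambda>t. x t $ 3) has_real_derivative 0) (at t)" by blast
  from DERIV_isconst_all[OF this] show ?thesis .
qed

lemma conn_x: "conn \<kappa> \<tau> (x t) = (\<tau> / 2) *\<^sub>R x t + \<omega> *\<^sub>R axis 3 1"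
  by (simp add: conn_def x3_const[of t] \<omega>_def)

lemma unit_axis: "axis 3 1 \<bullet> (axis 3 1 :: real^3) = 1"
  by (simp add: inner_axis_axis)

text \<open>The summand of the connection proportional to \<open>x\<close> cancels in the cross
  product with \<open>x\<close>. What remains is the rotation equation about the axis with constant
  speed, solved uniquely by \<open>cross_ode_zero\<close>.\<close>

lemma x_eq: "x t = rot (axis 3 1) (- \<omega> * t) (x 0)"
proof -
  let ?d = "\<lambda>t. x t - rot (axis 3 1) (- \<omega> * t) (x 0)"
  have "(?d has_vector_derivative (- \<omega> *\<^sub>R axis 3 1) \<times> ?d t) (at t)" for t
    using has_vector_derivative_diff[OF x_derivative
        rot_has_vector_derivative[OF unit_axis has_vector_derivative_const]]
    by (rule has_vector_derivative_eq_rhs)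
      (simp add: conn_x linear_0[OF linear_rot] cross_add_left cross_mult_left
        Cross3.left_diff_distrib Cross3.right_diff_distrib algebra_simps)
  then have "?d t = 0"
    by (rule cross_ode_zero) simp
  then show ?thesis by simp
qed

section \<open>Parallel translation\<close>

definition P :: "real \<Rightarrow> real^3 \<Rightarrow> real^3" where
  "P t y = rot (axis 3 1) (- \<omega> * t) (rot (x 0) (- (\<tau> / 2) * t) y)"

lemma P_0 [simp]: "P 0 y = y"
  by (simp add: P_def)

text \<open>The outer rotation contributes the axis term. The inner one contributes a cross product
  with \<open>x 0\<close>, which the outer rotation carries to \<open>x t\<close>, as it respects
  cross products.\<close>

lemma P_derivative: "((\<lambda>t. P t y) has_vector_derivative (- conn \<kappa> \<tau> (x t)) \<times> P t y) (at t)"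
  unfolding P_def conn_x
  using rot_has_vector_derivative[OF unit_axis
      rot_has_vector_derivative[OF inner_x has_vector_derivative_const], of "- \<omega>" 0 "- (\<tau> / 2)" y t]
  by (rule has_vector_derivative_eq_rhs)
    (simp add: linear_0[OF linear_rot] linear_scale[OF linear_rot] linear_neg[OF linear_rot]
      rot_e3_cross cross_add_left cross_mult_left Cross3.left_diff_distrib x_eq[of t])

lemma smooth_P: "smooth_on UNIV (\<lambda>t. P t y)"
  unfolding smooth_on_def P_def by (intro allI Ck_on_rot Ck_on_const open_UNIV)

lemma inv_P: "rot (x 0) (\<tau> / 2 * t) (rot (axis 3 1) (\<omega> * t) (P t y)) = y"
  using rot_minus_rot[OF unit_axis, of "- \<omega> * t"] rot_minus_rot[OF inner_x, of 0 "- (\<tau> / 2) * t"]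
  by (simp add: P_def)

text \<open>\<open>P\<close> supplies a parallel field, and the difference of two parallel fields
  with the same initial value vanishes by \<open>cross_ode_zero\<close>; so the definite description
  is well defined.\<close>

lemma parallel_translation_eq:
  "parallel_translation A g u nabla \<gamma> t (frame_comb u (\<gamma> 0) y) = frame_comb u (\<gamma> t) (P t y)"
  unfolding parallel_translation_def
proof (rule the_equality)
  have "parallel_along A g u nabla \<gamma> (\<lambda>t. frame_comb u (\<gamma> t) (P t y))"
    unfolding parallel_iff using smooth_P P_derivative by blast
  then show "\<exists>V. parallel_along A g u nabla \<gamma> V \<and> V 0 = frame_comb u (\<gamma> 0) y \<and> V t = frame_comb u (\<gamma> t) (P t y)"
    by (intro exI[of _ "\<lambda>t. frame_comb u (\<gamma> t) (P t y)"]) simp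
  fix w assume "\<exists>V. parallel_along A g u nabla \<gamma> V \<and> V 0 = frame_comb u (\<gamma> 0) y \<and> V t = w"
  then obtain V where V: "parallel_along A g u nabla \<gamma> V" "V 0 = frame_comb u (\<gamma> 0) y" "V t = w"
    by blast
  define z where "z t = coords g u (\<gamma> t) (V t)" for t
  have "V t \<in> tangent_space A (\<gamma> t)" for t
    using V(1) by (simp add: parallel_along_def smooth_field_along_def)
  then have z: "V t = frame_comb u (\<gamma> t) (z t)" for t
    unfolding z_def by (rule tangent_eq_frame_comb)
  then have "V = (\<lambda>t. frame_comb u (\<gamma> t) (z t))" by blast
  then have dz: "(z has_vector_derivative (- conn \<kappa> \<tau> (x t)) \<times> z t) (at t)" for t
    using V(1) parallel_iff by blast
  have "((\<lambda>t. z t - P t y) has_vector_derivative (- conn \<kappa> \<tau> (x t)) \<times> (z t - P t y)) (at t)" for t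
    using has_vector_derivative_diff[OF dz P_derivative]
    by (rule has_vector_derivative_eq_rhs) (simp add: Cross3.right_diff_distrib)
  moreover have "z 0 - P 0 y = 0"
    by (simp add: z_def V(2))
  ultimately have "z t - P t y = 0"
    by (rule cross_ode_zero[where d = "\<lambda>t. z t - P t y"])
  then show "w = frame_comb u (\<gamma> t) (P t y)"
    using V(3) z[of t] by simp
qed

text \<open>The rotation about the axis takes \<open>x 0\<close> to \<open>x t\<close> and commutes
  with \<open>jac\<close>, so it cancels; only the conjugation by the rotation about
  \<open>x 0\<close> remains.\<close>

lemma transported_jacobi_operator_eq:
  "transported_jacobi_operator A g u nabla \<gamma> t (frame_comb u (\<gamma> 0) y) =
    frame_comb u (\<gamma> 0) (rot (x 0) (\<tau> / 2 * t) (jac \<kappa> \<tau> (x 0) (rot (x 0) (- (\<tau> / 2 * t)) y)))"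
    (is "_ = frame_comb u (\<gamma> 0) ?z")
proof -
  have "jac \<kappa> \<tau> (x t) (P t y) = P t ?z"
    using rot_minus_rot[OF inner_x, of 0 "\<tau> / 2 * t"]
    by (simp add: P_def x_eq[of t] jac_rot_e3)
  then have J: "jacobi_operator A g u nabla (\<gamma> t) (velocity A \<gamma> t)
      (parallel_translation A g u nabla \<gamma> t (frame_comb u (\<gamma> 0) y)) =
      parallel_translation A g u nabla \<gamma> t (frame_comb u (\<gamma> 0) ?z)"
    unfolding parallel_translation_eq velocity_eq jacobi_operator_frame_comb by simp
  \<comment> \<open>Injectivity is what makes \<open>inv_into\<close> the true inverse of parallel
    translation.\<close>
  have "inj_on (parallel_translation A g u nabla \<gamma> t) (tangent_space A (\<gamma> 0))"
  proof (rule inj_onI)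
    fix v w assume vw: "v \<in> tangent_space A (\<gamma> 0)" "w \<in> tangent_space A (\<gamma> 0)"
      "parallel_translation A g u nabla \<gamma> t v = parallel_translation A g u nabla \<gamma> t w"
    obtain a b where ab: "v = frame_comb u (\<gamma> 0) a" "w = frame_comb u (\<gamma> 0) b"
      using vw tangent_eq_frame_comb by blast
    then have "P t a = P t b"
      using vw(3) by (simp add: parallel_translation_eq frame_comb_inject)
    then show "v = w" using ab inv_P by metis
  qed
  then show ?thesis
    unfolding transported_jacobi_operator_def comp_apply J
    by (rule inv_into_f_f) (rule frame_comb_tangent)
qed

end

context M3
begin

lemma operator_matrix_frame_comb:
  assumes "\<And>y. K (frame_comb u p y) = frame_comb u p (L y)"
  shows "operator_matrix g u p K = (\<chi> i j. L (axis j 1) $ i)"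
proof -
  have "g p (u i p) (frame_comb u p c) = c $ i" for i c
    using g_frame_comb_frame_comb[of p "axis i 1" c] by (simp add: frame_comb_axis inner_axis')
  then show ?thesis
    unfolding operator_matrix_def frame_comb_axis[symmetric, of _ p] assms
    by (simp add: frame_comb_axis)
qed

end

context M3_geodesic
begin

section \<open>The Jacobi curve as a trigonometric curve\<close>

definition w :: "real^3" where "w = axis 3 1 \<times> x 0"
definition w' :: "real^3" where "w' = x 0 \<times> w"

text \<open>Pulled back by parallel translation, \<open>e\<^sub>3 \<times> x(t)\<close> becomes \<open>cos(\<tau>t/2) w + sin(\<tau>t/2) w'\<close>; the double-angle
  formulas split the square of this vector into the following three matrices.\<close>

definition X0 :: "real^3^3" where
  "X0 = (\<tau>\<^sup>2 / 4) *\<^sub>R (mat 1 - outer (x 0) (x 0)) + ((\<kappa> - \<tau>\<^sup>2) / 2) *\<^sub>R (outer w w + outer w' w')"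
definition Y0 :: "real^3^3" where "Y0 = ((\<kappa> - \<tau>\<^sup>2) / 2) *\<^sub>R (outer w w - outer w' w')"
definition Z0 :: "real^3^3" where "Z0 = ((\<kappa> - \<tau>\<^sup>2) / 2) *\<^sub>R (outer w w' + outer w' w)"

lemma jacobi_curve_eq: "jacobi_curve A g u nabla \<gamma> = (\<lambda>t. X0 + cos (\<tau> * t) *\<^sub>R Y0 + sin (\<tau> * t) *\<^sub>R Z0)"
proof
  fix t
  define C S where "C = cos (\<tau> / 2 * t)" and "S = sin (\<tau> / 2 * t)"
  have "C * C + S * S = 1"
    using sin_cos_squared_add2[of "\<tau> / 2 * t"] by (simp add: C_def S_def power2_eq_square)
  moreover have "cos (\<tau> * t) = C * C - S * S" "sin (\<tau> * t) = 2 * S * C"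
    using cos_double[of "\<tau> / 2 * t"] sin_double[of "\<tau> / 2 * t"] by (simp_all add: C_def S_def power2_eq_square)
  \<comment> \<open>The double-angle identity for one matrix entry: \<open>a\<close>,
    \<open>a'\<close> will be the components of \<open>w\<close>, \<open>w'\<close> with index
    \<open>j\<close>, and \<open>b\<close>, \<open>b'\<close> those with index
    \<open>i\<close>.\<close>
  moreover have "(k * ((C * a + S * a') * (C * b + S * b'))) =
      k / 2 * (a * b + a' * b') + ((C * C - S * S) * (k / 2 * (a * b - a' * b')) + 2 * S * C * (k / 2 * (a * b' + a' * b)))"
    if "C * C + S * S = 1" for k a b a' b' :: real
  proof -
    have "k * ((C * a + S * a') * (C * b + S * b')) =
      (C * C + S * S) * (k / 2 * (a * b + a' * b')) + ((C * C - S * S) * (k / 2 * (a * b - a' * b')) + 2 * S * C * (k / 2 * (a * b' + a' * b)))"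
      by (simp add: field_simps)
    then show ?thesis using that by simp
  qed
  ultimately have key: "k * ((C * a + S * a') * (C * b + S * b')) =
      k / 2 * (a * b + a' * b') + (cos (\<tau> * t) * (k / 2 * (a * b - a' * b')) + sin (\<tau> * t) * (k / 2 * (a * b' + a' * b)))"
    for k a b a' b' :: real by metis
  have ax: "v \<bullet> axis j 1 = v $ j" for v :: "real^3" and j
    by (simp add: inner_axis)
  have "jacobi_curve A g u nabla \<gamma> t $ i $ j = (X0 + cos (\<tau> * t) *\<^sub>R Y0 + sin (\<tau> * t) *\<^sub>R Z0) $ i $ j" for i j
    unfolding jacobi_curve_def operator_matrix_frame_comb[where L = "\<lambda>y. rot (x 0) (\<tau> / 2 * t) (jac \<kappa> \<tau> (x 0) (rot (x 0) (- (\<tau> / 2 * t)) y))",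
          OF transported_jacobi_operator_eq]
      rot_jac_rot[OF inner_x[of 0], folded w_def] w'_def[symmetric] C_def[symmetric] S_def[symmetric] ax
    using key[of "\<kappa> - \<tau>\<^sup>2" "w $ j" "w' $ j" "w $ i" "w' $ i"]
    by (simp add: X0_def Y0_def Z0_def outer_def mat_def axis_def algebra_simps)
  then show "jacobi_curve A g u nabla \<gamma> t = X0 + cos (\<tau> * t) *\<^sub>R Y0 + sin (\<tau> * t) *\<^sub>R Z0"
    by (simp add: vec_eq_iff)
qed

text \<open>\<open>w\<close> is orthogonal to the unit vector \<open>x 0\<close>, so
  \<open>w'\<close> is \<open>w\<close> turned by a right angle about it. The last equation is the
  Lagrange identity for two unit vectors.\<close>

lemma w_orthogonal: "w \<bullet> w' = 0" "w' \<bullet> w' = w \<bullet> w" "w \<bullet> w = 1 - (x 0 $ 3)\<^sup>2"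
proof -
  show "w \<bullet> w' = 0" by (simp add: w'_def dot_cross_self)
  show "w' \<bullet> w' = w \<bullet> w"
    by (simp add: w'_def dot_cross inner_x) (simp add: w_def dot_cross_self)
  show "w \<bullet> w = 1 - (x 0 $ 3)\<^sup>2"
    using inner_x[of 0] by (simp add: w_def dot_cross inner_axis inner_axis' unit_axis power2_eq_square)
qed

text \<open>The four outer products of \<open>w\<close> and \<open>w'\<close> are mutually
  orthogonal of squared length |w|^4. Their sums and differences in pairs have twice that squared
  length, which with the factor 1/2 in \<open>Y0\<close> and \<open>Z0\<close> produces
  \<open>sqrt 2 / 2\<close>.\<close>

lemma inner_YZ:
  "Y0 \<bullet> Z0 = 0"
  "Y0 \<bullet> Y0 = (sqrt 2 / 2 * \<bar>\<tau>\<^sup>2 - \<kappa>\<bar> * (w \<bullet> w))\<^sup>2"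
  "Z0 \<bullet> Z0 = (sqrt 2 / 2 * \<bar>\<tau>\<^sup>2 - \<kappa>\<bar> * (w \<bullet> w))\<^sup>2"
proof -
  have ww: "w' \<bullet> w = 0" using w_orthogonal(1) by (simp add: inner_commute)
  show "Y0 \<bullet> Z0 = 0"
    by (simp add: Y0_def Z0_def inner_diff_left inner_add_right inner_outer w_orthogonal(1,2) ww)
  have r: "(sqrt 2 / 2 * \<bar>\<tau>\<^sup>2 - \<kappa>\<bar> * a)\<^sup>2 = ((\<kappa> - \<tau>\<^sup>2) / 2) * (((\<kappa> - \<tau>\<^sup>2) / 2) * (a * a + a * a))" for a
    by (simp add: power_mult_distrib power_divide) (simp add: power2_eq_square field_simps)
  show "Y0 \<bullet> Y0 = (sqrt 2 / 2 * \<bar>\<tau>\<^sup>2 - \<kappa>\<bar> * (w \<bullet> w))\<^sup>2"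
    unfolding r by (simp add: Y0_def inner_diff_left inner_diff_right inner_outer w_orthogonal(1,2) ww)
  show "Z0 \<bullet> Z0 = (sqrt 2 / 2 * \<bar>\<tau>\<^sup>2 - \<kappa>\<bar> * (w \<bullet> w))\<^sup>2"
    unfolding r by (simp add: Z0_def inner_add_left inner_add_right inner_outer w_orthogonal(1,2) ww)
qed

section \<open>Hopf fibers, osculating rank and the circle\<close>

lemma hopf_fiber_iff: "hopf_fiber A u \<gamma> \<longleftrightarrow> w = 0"
proof
  have n: "(\<lambda>f. - u 3 p f) = frame_comb u p (- axis 3 1)" for p
    unfolding frame_comb_linear frame_comb_axis ..
  { assume "hopf_fiber A u \<gamma>"
    then have "x 0 = axis 3 1 \<or> x 0 = - axis 3 1"
      unfolding hopf_fiber_def velocity_eq n unfolding frame_comb_axis[symmetric, of 3] frame_comb_inject by blast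
    then show "w = 0" by (auto simp: w_def) }
  assume "w = 0"
  then have "(x 0 $ 3)\<^sup>2 = 1"
    using w_orthogonal(3) by simp
  \<comment> \<open>The double cross product with the axis vector vanishes, so \<open>x 0\<close>
    equals its projection to the axis.\<close>
  moreover have "x 0 = (x 0 $ 3) *\<^sub>R axis 3 1"
    using Lagrange[of "axis 3 1" "axis 3 1" "x 0"] \<open>w = 0\<close>
    by (simp add: w_def inner_axis' unit_axis)
  ultimately have "x 0 = axis 3 1 \<or> x 0 = - axis 3 1"
    by (metis power2_eq_1_iff scaleR_minus1_left scaleR_one)
  \<comment> \<open>A velocity along the axis is fixed by the rotation that moves it, so it stays
    there for all times.\<close>
  moreover have "rot (axis 3 1) s (axis 3 1) = axis 3 1" for s
    unfolding vec_eq_iff forall_3 rot_e3_components by (simp add: axis_def)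
  ultimately have "(\<forall>t. x t = axis 3 1) \<or> (\<forall>t. x t = - axis 3 1)"
    using x_eq linear_neg[OF linear_rot] by metis
  then show "hopf_fiber A u \<gamma>"
    unfolding hopf_fiber_def velocity_eq n unfolding frame_comb_axis[symmetric, of 3] frame_comb_inject .
qed

lemma jacobi_osculating_rank:
  assumes "\<kappa> \<noteq> \<tau>\<^sup>2"
  shows "has_jacobi_osculating_rank A g u nabla \<gamma> (if hopf_fiber A u \<gamma> then 0 else 2)"
proof (cases "w = 0")
  case True
  moreover have "w' = 0"
    using True by (simp add: w'_def)
  moreover have "outer 0 0 = (0 :: real^3^3)"
    by (simp add: outer_def vec_eq_iff)
  ultimately have "Y0 = 0" "Z0 = 0"
    by (simp_all add: Y0_def Z0_def)
  then show ?thesis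
    unfolding has_jacobi_osculating_rank_def jacobi_curve_eq hopf_fiber_iff
    using True osculating_rank_const by simp
next
  case False
  \<comment> \<open>Here \<open>r\<close> is the common squared length of \<open>Y0\<close> and
    \<open>Z0\<close>; pairing a relation with each of them isolates its coefficients.\<close>
  define r where "r = (sqrt 2 / 2 * \<bar>\<tau>\<^sup>2 - \<kappa>\<bar> * (w \<bullet> w))\<^sup>2"
  have "r \<noteq> 0" using False assms by (simp add: r_def)
  have "a = 0 \<and> b = 0" if "a *\<^sub>R Y0 + b *\<^sub>R Z0 = 0" for a b
  proof -
    have "a * r = (a *\<^sub>R Y0 + b *\<^sub>R Z0) \<bullet> Y0" "b * r = (a *\<^sub>R Y0 + b *\<^sub>R Z0) \<bullet> Z0"
      using inner_YZ inner_commute[of Z0 Y0] by (simp_all add: inner_add_left r_def)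
    then show ?thesis unfolding that using \<open>r \<noteq> 0\<close> by simp
  qed
  then show ?thesis
    unfolding has_jacobi_osculating_rank_def jacobi_curve_eq hopf_fiber_iff
    using False tau by (simp add: osculating_rank_trig_2)
qed

text \<open>The values at 0 are R = X0 + Y0, R' = \<tau> Z0 and R'' = -\<tau>^2 Y0; substituting
  them returns the trigonometric form.\<close>

lemma jacobi_curve_expansion:
  "jacobi_curve A g u nabla \<gamma> t =
     operator_matrix g u (\<gamma> 0) (jacobi_operator A g u nabla (\<gamma> 0) (velocity A \<gamma> 0)) +
     (1 / \<tau>) *\<^sub>R (sin (\<tau> * t) *\<^sub>R curve_deriv 1 (jacobi_curve A g u nabla \<gamma>) 0 +
       (1 / \<tau>) *\<^sub>R ((1 - cos (\<tau> * t)) *\<^sub>R curve_deriv 2 (jacobi_curve A g u nabla \<gamma>) 0))"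
proof -
  have "operator_matrix g u (\<gamma> 0) (jacobi_operator A g u nabla (\<gamma> 0) (velocity A \<gamma> 0)) =
      jacobi_curve A g u nabla \<gamma> 0"
    unfolding jacobi_curve_def velocity_eq
      operator_matrix_frame_comb[where L = "jac \<kappa> \<tau> (x 0)", OF jacobi_operator_frame_comb]
      operator_matrix_frame_comb[where L = "\<lambda>y. rot (x 0) (\<tau> / 2 * 0) (jac \<kappa> \<tau> (x 0) (rot (x 0) (- (\<tau> / 2 * 0)) y))",
        OF transported_jacobi_operator_eq] by simp
  then have o: "operator_matrix g u (\<gamma> 0) (jacobi_operator A g u nabla (\<gamma> 0) (velocity A \<gamma> 0)) = X0 + Y0"
    by (simp add: jacobi_curve_eq)
  show ?thesis
    unfolding o jacobi_curve_eq curve_deriv_trig_123 using tau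
    by (simp add: algebra_simps)
qed

lemma jacobi_curve_circle:
  assumes "\<kappa> \<noteq> \<tau>\<^sup>2" "w \<noteq> 0"
  shows "circle_in symmetric_matrices (sqrt 2 / 2 * \<bar>\<tau>\<^sup>2 - \<kappa>\<bar> * (w \<bullet> w)) (range (jacobi_curve A g u nabla \<gamma>))"
  unfolding jacobi_curve_eq
proof (rule trig_circle)
  have o: "outer a a \<in> symmetric_matrices" "outer a b + outer b a \<in> symmetric_matrices" for a b :: "real^3"
    by (simp_all add: symmetric_matrices_def outer_def transpose_def vec_eq_iff mult.commute add.commute)
  have m: "mat 1 \<in> symmetric_matrices"
    by (simp add: symmetric_matrices_def)
  note sub = subspace_symmetric_matrices
  show "X0 \<in> symmetric_matrices" "Y0 \<in> symmetric_matrices" "Z0 \<in> symmetric_matrices"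
    unfolding X0_def Y0_def Z0_def
    by (intro subspace_add[OF sub] subspace_diff[OF sub] subspace_scale[OF sub] o m)+
qed (use assms tau inner_YZ subspace_symmetric_matrices in auto)

end

theorem theorem4p3:
  fixes \<kappa> \<tau> :: real
    and G :: "'m::{t2_space,second_countable_topology} monoid"
    and A :: "('m, real^3) atlas"
    and u :: "3 \<Rightarrow> 'm field"
    and g :: "'m \<Rightarrow> 'm tangent \<Rightarrow> 'm tangent \<Rightarrow> real"
    and nabla :: "'m field \<Rightarrow> 'm field \<Rightarrow> 'm field"
  assumes "\<tau> > 0" and "\<kappa> \<noteq> \<tau>\<^sup>2"
    and "M3_space \<kappa> \<tau> G A u g"
    and "levi_civita A g nabla"
  shows "(\<forall>\<gamma>. unit_geodesic A g u nabla \<gamma> \<longrightarrow>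
            has_jacobi_osculating_rank A g u nabla \<gamma> (if hopf_fiber A u \<gamma> then 0 else 2)) \<and>
         (\<forall>v \<gamma>. v \<in> tangent_space A \<one>\<^bsub>G\<^esub> \<and> g \<one>\<^bsub>G\<^esub> v v = 1 \<and>
            unit_geodesic A g u nabla \<gamma> \<and> \<gamma> 0 = \<one>\<^bsub>G\<^esub> \<and> velocity A \<gamma> 0 = v \<longrightarrow>
            (\<forall>t. jacobi_curve A g u nabla \<gamma> t =
               operator_matrix g u \<one>\<^bsub>G\<^esub> (jacobi_operator A g u nabla \<one>\<^bsub>G\<^esub> v) +
               (1 / \<tau>) *\<^sub>R (sin (\<tau> * t) *\<^sub>R curve_deriv 1 (jacobi_curve A g u nabla \<gamma>) 0 +
                 (1 / \<tau>) *\<^sub>R ((1 - cos (\<tau> * t)) *\<^sub>R curve_deriv 2 (jacobi_curve A g u nabla \<gamma>) 0))) \<and>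
            (\<forall>\<theta> \<phi>. \<theta> \<in> {0<..<pi} \<and> \<phi> \<in> {0..2 * pi} \<and> v = angular_vector u \<one>\<^bsub>G\<^esub> \<theta> \<phi> \<longrightarrow>
               circle_in symmetric_matrices (sqrt 2 / 2 * \<bar>\<tau>\<^sup>2 - \<kappa>\<bar> * (sin \<theta>)\<^sup>2)
                 (range (jacobi_curve A g u nabla \<gamma>))))"
proof (intro conjI allI impI)
  have M3: "M3 \<kappa> \<tau> G A u g nabla"
    using assms by unfold_locales
  fix \<gamma> assume "unit_geodesic A g u nabla \<gamma>"
  then interpret M3_geodesic \<kappa> \<tau> G A u g nabla \<gamma>
    using M3 by (simp add: M3_geodesic_def M3_geodesic_axioms_def)
  show "has_jacobi_osculating_rank A g u nabla \<gamma> (if hopf_fiber A u \<gamma> then 0 else 2)"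
    by (rule jacobi_osculating_rank[OF assms(2)])
next
  have M3: "M3 \<kappa> \<tau> G A u g nabla"
    using assms by unfold_locales
  fix v \<gamma>
  assume v: "v \<in> tangent_space A \<one>\<^bsub>G\<^esub> \<and> g \<one>\<^bsub>G\<^esub> v v = 1 \<and>
    unit_geodesic A g u nabla \<gamma> \<and> \<gamma> 0 = \<one>\<^bsub>G\<^esub> \<and> velocity A \<gamma> 0 = v"
  then interpret M3_geodesic \<kappa> \<tau> G A u g nabla \<gamma>
    using M3 by (simp add: M3_geodesic_def M3_geodesic_axioms_def)
  show "jacobi_curve A g u nabla \<gamma> t =
      operator_matrix g u \<one>\<^bsub>G\<^esub> (jacobi_operator A g u nabla \<one>\<^bsub>G\<^esub> v) +
      (1 / \<tau>) *\<^sub>R (sin (\<tau> * t) *\<^sub>R curve_deriv 1 (jacobi_curve A g u nabla \<gamma>) 0 +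
        (1 / \<tau>) *\<^sub>R ((1 - cos (\<tau> * t)) *\<^sub>R curve_deriv 2 (jacobi_curve A g u nabla \<gamma>) 0))" for t
    using jacobi_curve_expansion[of t] v by simp
  fix \<theta> \<phi> assume \<theta>: "\<theta> \<in> {0<..<pi} \<and> \<phi> \<in> {0..2 * pi} \<and> v = angular_vector u \<one>\<^bsub>G\<^esub> \<theta> \<phi>"
  then have "x 0 = vector [sin \<theta> * cos \<phi>, sin \<theta> * sin \<phi>, cos \<theta>]"
    using v by (simp add: x_def angular_vector_def)
  \<comment> \<open>The third component of the velocity is cos \<theta>, so |w|^2 = 1 - cos^2
    \<theta>.\<close>
  then have ww: "w \<bullet> w = (sin \<theta>)\<^sup>2"
    using w_orthogonal(3) by (simp add: sin_squared_eq)
  moreover have "sin \<theta> > 0"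
    using \<theta> sin_gt_zero by simp
  ultimately have "w \<noteq> 0" by auto
  from jacobi_curve_circle[OF assms(2) this]
  show "circle_in symmetric_matrices (sqrt 2 / 2 * \<bar>\<tau>\<^sup>2 - \<kappa>\<bar> * (sin \<theta>)\<^sup>2) (range (jacobi_curve A g u nabla \<gamma>))"
    unfolding ww .
qed

end
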